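(* There exists a constant $c$ such that for every $n$, no statement of the form "$\mathrm{C}(x)>n+c$" (for any string $x$) is provable in the theory $A_n=\mathsf{PA}+\{\mathrm{C}(r_n)\ge n\}$.
   Context: $\mathsf{PA}$ is Peano arithmetic. $\mathrm{C}$ is plain Kolmogorov complexity, represented in $\mathsf{PA}$ as $\mathrm{C}_D(x)=\min\{|p|:D(p)=x\}$ for a provably optimal interpreter $D$ (for every partial computable $D'$ there is $c'$ with $\mathsf{PA}\vdash\forall x\,[\mathrm{C}_D(x)\le\mathrm{C}_{D'}(x)+c']$). $r_n$ denotes the lexicographically first binary string of length $n$ with $\mathrm{C}(r_n)\ge n$. *)

theory Defs
  imports Main "HOL-Library.Extended_Nat" "HOL-Library.List_Lexorder"
begin

subsection \<open>First-order arithmetic\<close>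

text \<open>Variables are de Bruijn indices: \<open>Var 0\<close> is bound by the innermost quantifier.\<close>

datatype tm = Var nat | Zr | Sc tm | Add tm tm | Mul tm tm

datatype fm = Fls | Eq tm tm | Imp fm fm | Forall fm

abbreviation Neg :: "fm \<Rightarrow> fm" where
  "Neg \<phi> \<equiv> Imp \<phi> Fls"

abbreviation And :: "fm \<Rightarrow> fm \<Rightarrow> fm" where
  "And \<phi> \<psi> \<equiv> Neg (Imp \<phi> (Neg \<psi>))"

abbreviation Exists :: "fm \<Rightarrow> fm" where
  "Exists \<phi> \<equiv> Neg (Forall (Neg \<phi>))"

text \<open>Index-shifting: the variables with index at least \<open>k\<close> are raised by one.\<close>

primrec lift_tm :: "nat \<Rightarrow> tm \<Rightarrow> tm" where
  "lift_tm k (Var n) = (if n < k then Var n else Var (Suc n))"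
| "lift_tm k Zr = Zr"
| "lift_tm k (Sc t) = Sc (lift_tm k t)"
| "lift_tm k (Add s t) = Add (lift_tm k s) (lift_tm k t)"
| "lift_tm k (Mul s t) = Mul (lift_tm k s) (lift_tm k t)"

primrec lift_fm :: "nat \<Rightarrow> fm \<Rightarrow> fm" where
  "lift_fm k Fls = Fls"
| "lift_fm k (Eq s t) = Eq (lift_tm k s) (lift_tm k t)"
| "lift_fm k (Imp \<phi> \<psi>) = Imp (lift_fm k \<phi>) (lift_fm k \<psi>)"
| "lift_fm k (Forall \<phi>) = Forall (lift_fm (Suc k) \<phi>)"

text \<open>Substitution of \<open>u\<close> for variable \<open>k\<close>, which disappears: higher indices drop by one.\<close>

primrec subst_tm :: "nat \<Rightarrow> tm \<Rightarrow> tm \<Rightarrow> tm" where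
  "subst_tm k u (Var n) = (if n < k then Var n else if n = k then u else Var (n - 1))"
| "subst_tm k u Zr = Zr"
| "subst_tm k u (Sc t) = Sc (subst_tm k u t)"
| "subst_tm k u (Add s t) = Add (subst_tm k u s) (subst_tm k u t)"
| "subst_tm k u (Mul s t) = Mul (subst_tm k u s) (subst_tm k u t)"

primrec subst_fm :: "nat \<Rightarrow> tm \<Rightarrow> fm \<Rightarrow> fm" where
  "subst_fm k u Fls = Fls"
| "subst_fm k u (Eq s t) = Eq (subst_tm k u s) (subst_tm k u t)"
| "subst_fm k u (Imp \<phi> \<psi>) = Imp (subst_fm k u \<phi>) (subst_fm k u \<psi>)"
| "subst_fm k u (Forall \<phi>) = Forall (subst_fm (Suc k) (lift_tm 0 u) \<phi>)"

text \<open>Classical first-order logic with equality. Because of the generalization rule, an axiom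
  with free variables counts as its universal closure.\<close>

inductive provable :: "fm set \<Rightarrow> fm \<Rightarrow> bool" (infix "\<turnstile>" 50) for T :: "fm set" where
  Ax: "\<phi> \<in> T \<Longrightarrow> T \<turnstile> \<phi>"
| K: "T \<turnstile> Imp \<phi> (Imp \<psi> \<phi>)"
| S: "T \<turnstile> Imp (Imp \<phi> (Imp \<psi> \<chi>)) (Imp (Imp \<phi> \<psi>) (Imp \<phi> \<chi>))"
| DN: "T \<turnstile> Imp (Neg (Neg \<phi>)) \<phi>"
| Inst: "T \<turnstile> Imp (Forall \<phi>) (subst_fm 0 t \<phi>)"
| Dist: "T \<turnstile> Imp (Forall (Imp \<phi> \<psi>)) (Imp (Forall \<phi>) (Forall \<psi>))"
| Vac: "T \<turnstile> Imp \<phi> (Forall (lift_fm 0 \<phi>))"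
| Refl: "T \<turnstile> Eq t t"
| Leibniz: "T \<turnstile> Imp (Eq s t) (Imp (subst_fm 0 s \<phi>) (subst_fm 0 t \<phi>))"
| MP: "T \<turnstile> Imp \<phi> \<psi> \<Longrightarrow> T \<turnstile> \<phi> \<Longrightarrow> T \<turnstile> \<psi>"
| Gen: "T \<turnstile> \<phi> \<Longrightarrow> T \<turnstile> Forall \<phi>"

text \<open>In the induction axiom \<open>subst_fm 0 (Sc (Var 0)) (lift_fm 1 \<phi>)\<close> is \<open>\<phi>(S x)\<close>, where
  \<open>x\<close> is variable 0 of \<open>\<phi>\<close> and the other free variables of \<open>\<phi>\<close> are parameters.\<close>

definition induction_axiom :: "fm \<Rightarrow> fm" where
  "induction_axiom \<phi> =
     Imp (subst_fm 0 Zr \<phi>)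
       (Imp (Forall (Imp \<phi> (subst_fm 0 (Sc (Var 0)) (lift_fm 1 \<phi>)))) (Forall \<phi>))"

definition PA :: "fm set" where
  "PA =
     {Forall (Neg (Eq (Sc (Var 0)) Zr)),
      Forall (Forall (Imp (Eq (Sc (Var 1)) (Sc (Var 0))) (Eq (Var 1) (Var 0)))),
      Forall (Eq (Add (Var 0) Zr) (Var 0)),
      Forall (Forall (Eq (Add (Var 1) (Sc (Var 0))) (Sc (Add (Var 1) (Var 0))))),
      Forall (Eq (Mul (Var 0) Zr) Zr),
      Forall (Forall (Eq (Mul (Var 1) (Sc (Var 0))) (Add (Mul (Var 1) (Var 0)) (Var 1))))}
     \<union> range induction_axiom"

primrec numeral_tm :: "nat \<Rightarrow> tm" where
  "numeral_tm 0 = Zr"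
| "numeral_tm (Suc n) = Sc (numeral_tm n)"

abbreviation lifts :: "nat \<Rightarrow> tm \<Rightarrow> tm" where
  "lifts k t \<equiv> (lift_tm 0 ^^ k) t"

definition Le :: "tm \<Rightarrow> tm \<Rightarrow> fm" where
  "Le s t = Exists (Eq (Add (lifts 1 s) (Var 0)) (lifts 1 t))"

definition Lt :: "tm \<Rightarrow> tm \<Rightarrow> fm" where
  "Lt s t = Le (Sc s) t"


subsection \<open>Partial recursive functions\<close>

datatype recf =
    RZero
  | RSucc
  | RProj nat
  | RComp recf "recf list"
  | RPrec recf recf
  | RMin recf

fun has_arity :: "recf \<Rightarrow> nat \<Rightarrow> bool" where
  "has_arity RZero n \<longleftrightarrow> True"
| "has_arity RSucc n \<longleftrightarrow> n = 1"
| "has_arity (RProj i) n \<longleftrightarrow> i < n"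
| "has_arity (RComp f gs) n \<longleftrightarrow> has_arity f (length gs) \<and> (\<forall>g\<in>set gs. has_arity g n)"
| "has_arity (RPrec f g) n \<longleftrightarrow> 0 < n \<and> has_arity f (n - 1) \<and> has_arity g (n + 1)"
| "has_arity (RMin f) n \<longleftrightarrow> has_arity f (n + 1)"

text \<open>\<open>RPrec\<close> recurses on the first argument, and its step function receives the counter, the
  previous value and the parameters, in this order. \<open>RMin f\<close> searches for the first argument
  of \<open>f\<close>, and is undefined if \<open>f\<close> diverges before its first zero.\<close>

fun ev :: "recf \<Rightarrow> nat list \<Rightarrow> nat option" where
  "ev RZero xs = Some 0"
| "ev RSucc xs = Some (Suc (hd xs))"
| "ev (RProj i) xs = Some (xs ! i)"
| "ev (RComp f gs) xs =
     (if \<exists>g\<in>set gs. ev g xs = None then None else ev f (map (\<lambda>g. the (ev g xs)) gs))"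
| "ev (RPrec f g) xs =
     rec_nat (ev f (tl xs)) (\<lambda>i r. Option.bind r (\<lambda>u. ev g (i # u # tl xs))) (hd xs)"
| "ev (RMin f) xs =
     (if \<exists>y. ev f (y # xs) = Some 0 \<and> (\<forall>z<y. \<exists>w. ev f (z # xs) = Some (Suc w))
      then Some (LEAST y. ev f (y # xs) = Some 0) else None)"


subsection \<open>Arithmetization of partial recursive functions\<close>

text \<open>\<open>Beta a b i y\<close> states \<open>y = a mod (1 + (i + 1) * b)\<close>, the value of Goedel's beta function.\<close>

definition Beta :: "tm \<Rightarrow> tm \<Rightarrow> tm \<Rightarrow> tm \<Rightarrow> fm" where
  "Beta a b i y =
     (let m = Sc (Mul (Sc i) b) in
      And (Lt y m) (Exists (Eq (lifts 1 a) (Add (Mul (Var 0) (lifts 1 m)) (lifts 1 y)))))"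

text \<open>\<open>Graph f ts t\<close> states that the function computed by \<open>f\<close> maps \<open>ts\<close> to \<open>t\<close>. The formula
  for \<open>RPrec\<close> says that some beta-coded sequence is a run of the recursion: after the two outer
  quantifiers the code is \<open>(Var 1, Var 0)\<close>.\<close>

fun Graph :: "recf \<Rightarrow> tm list \<Rightarrow> tm \<Rightarrow> fm"
  and Graphs :: "recf list \<Rightarrow> tm list \<Rightarrow> nat \<Rightarrow> fm" where
  "Graph RZero ts t = Eq t Zr"
| "Graph RSucc ts t = Eq t (Sc (hd ts))"
| "Graph (RProj i) ts t = Eq t (ts ! i)"
| "Graph (RComp f gs) ts t =
     (let k = length gs in
      (Exists ^^ k) (And (Graphs gs (map (lifts k) ts) 0) (Graph f (map Var [0..<k]) (lifts k t))))"
| "Graph (RPrec f g) ts t =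
     Exists (Exists (And
       (Exists (And (Beta (Var 2) (Var 1) Zr (Var 0)) (Graph f (map (lifts 3) (tl ts)) (Var 0))))
       (And
         (Forall (Imp (Lt (Var 0) (lifts 3 (hd ts)))
           (Exists (Exists (And (Beta (Var 4) (Var 3) (Var 2) (Var 1))
             (And (Beta (Var 4) (Var 3) (Sc (Var 2)) (Var 0))
               (Graph g (Var 2 # Var 1 # map (lifts 5) (tl ts)) (Var 0))))))))
         (Beta (Var 1) (Var 0) (lifts 2 (hd ts)) (lifts 2 t)))))"
| "Graph (RMin f) ts t =
     And (Graph f (t # ts) Zr)
       (Forall (Imp (Lt (Var 0) (lifts 1 t)) (Exists (Graph f (Var 1 # map (lifts 2) ts) (Sc (Var 0))))))"
| "Graphs [] ts i = Neg Fls"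
| "Graphs (g # gs) ts i = And (Graph g ts (Var i)) (Graphs gs ts (Suc i))"


subsection \<open>Binary strings and plain Kolmogorov complexity\<close>

text \<open>The bijection from binary strings to natural numbers given by the length-lexicographic
  order: \<open>1p\<close> is the binary notation of \<open>str_code p + 1\<close>.\<close>

definition str_code :: "bool list \<Rightarrow> nat" where
  "str_code p = foldl (\<lambda>v b. 2 * v + (if b then 2 else 1)) 0 p"

text \<open>A program of arity one is an interpreter, that is, a partial computable function from
  strings to strings. The value is \<open>\<infinity>\<close> if no \<open>p\<close> describes \<open>x\<close>.\<close>

definition plain_C :: "recf \<Rightarrow> bool list \<Rightarrow> enat" where
  "plain_C D x = (INF p \<in> {p. ev D [str_code p] = Some (str_code x)}. enat (length p))"

text \<open>For strings of equal length the order on lists is the lexicographic one with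
  \<open>False < True\<close>.\<close>

definition first_incompressible :: "recf \<Rightarrow> nat \<Rightarrow> bool list" where
  "first_incompressible D n = Min {x. length x = n \<and> plain_C D x \<ge> enat n}"

definition r_add :: recf where
  "r_add = RPrec (RProj 0) (RComp RSucc [RProj 1])"

definition r_pow2 :: recf where
  "r_pow2 = RPrec (RComp RSucc [RZero]) (RComp r_add [RProj 1, RProj 1])"

text \<open>The string with code \<open>p\<close> has length \<open>k\<close>: \<open>2 ^ k \<le> p + 1 < 2 * 2 ^ k\<close>.\<close>

definition Len :: "tm \<Rightarrow> tm \<Rightarrow> fm" where
  "Len p k =
     Exists (And (Graph r_pow2 [lifts 1 k] (Var 0))
       (And (Le (Var 0) (Sc (lifts 1 p))) (Lt (Sc (lifts 1 p)) (Add (Var 0) (Var 0)))))"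

text \<open>\<open>C_D(x) = k\<close>: \<open>k\<close> is the minimum of the lengths of the strings \<open>p\<close> with \<open>D(p) = x\<close>. As \<open>C_D(x)\<close>
  may be infinite, a lower bound on it speaks about all of its finite values, and an upper bound
  asserts that there is one.\<close>

definition C_eq :: "recf \<Rightarrow> tm \<Rightarrow> tm \<Rightarrow> fm" where
  "C_eq D x k =
     And (Exists (And (Graph D [Var 0] (lifts 1 x)) (Len (Var 0) (lifts 1 k))))
       (Forall (Forall (Imp (And (Graph D [Var 1] (lifts 2 x)) (Len (Var 1) (Var 0)))
         (Le (lifts 2 k) (Var 0)))))"

definition C_ge :: "recf \<Rightarrow> bool list \<Rightarrow> nat \<Rightarrow> fm" where
  "C_ge D x m = Forall (Imp (C_eq D (numeral_tm (str_code x)) (Var 0)) (Le (numeral_tm m) (Var 0)))"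

definition C_gt :: "recf \<Rightarrow> bool list \<Rightarrow> nat \<Rightarrow> fm" where
  "C_gt D x m = Forall (Imp (C_eq D (numeral_tm (str_code x)) (Var 0)) (Lt (numeral_tm m) (Var 0)))"

text \<open>\<open>\<forall>x. C_D(x) \<le> C_D'(x) + c\<close>; in the body \<open>x\<close> is \<open>Var 2\<close>, \<open>C_D'(x)\<close> is \<open>Var 1\<close>,
  \<open>C_D(x)\<close> is \<open>Var 0\<close>.\<close>

definition C_dominated :: "recf \<Rightarrow> recf \<Rightarrow> nat \<Rightarrow> fm" where
  "C_dominated D D' c =
     Forall (Forall (Imp (C_eq D' (Var 1) (Var 0))
       (Exists (And (C_eq D (Var 2) (Var 0)) (Le (Var 0) (Add (Var 1) (numeral_tm c)))))))"

definition provably_optimal :: "recf \<Rightarrow> bool" where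
  "provably_optimal D \<longleftrightarrow>
     has_arity D 1 \<and> (\<forall>D'. has_arity D' 1 \<longrightarrow> (\<exists>c. PA \<turnstile> C_dominated D D' c))"

definition A_theory :: "recf \<Rightarrow> nat \<Rightarrow> fm set" where
  "A_theory D n = PA \<union> {C_ge D (first_incompressible D n) n}"

end

theory Submission
  imports Defs "HOL-Number_Theory.Cong" "HOL-Library.Nat_Bijection"
begin

text \<open>This is Chaitin's argument, with all formulas read in the standard model. Let \<open>D'\<close> be the
  interpreter that, on the program \<open>r01\<^sup>c\<close>, searches for a proof of a statement
  \<open>C(x) > |r| + (2c + 1)\<close> in \<open>PA + {C(r) \<ge> |r|}\<close> and returns \<open>x\<close>. Fix \<open>c\<close> such that \<open>C\<^sub>D \<le> C\<^sub>D\<^sub>' + c\<close>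
  and take \<open>r = r\<^sub>n\<close>. If there were such a proof, then the string \<open>x\<close> returned would satisfy
  \<open>C\<^sub>D(x) > n + 2c + 1\<close>, because \<open>A\<^sub>n\<close> is sound, and \<open>C\<^sub>D(x) \<le> (n + 1 + c) + c\<close>, because the program
  has length \<open>n + 1 + c\<close>. Passing \<open>c\<close> in the program avoids the circularity that \<open>c\<close> depends on
  \<open>D'\<close>. Provability is expressed as derivability from finitely many Horn clauses over natural
  numbers, and one search procedure serves all sets of such clauses.\<close>

subsection \<open>The standard model\<close>

text \<open>The program carries \<open>r\<close> itself, so the search never has to decide which
  strings are incompressible, and \<open>n\<close> can be read off as the length of
  \<open>r\<close>. Only the suffix is overhead: the constant 2c + 1 is its length 1 + c plus the
  domination constant c. Nothing about the interpreter is proved inside PA. Provable optimality is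
  used only through its truth in the standard model, so any program whose behaviour is known in HOL
  will do. Two facts suffice: every answer comes from a genuine proof (soundness of the clauses),
  and the search halts if some proof exists (their completeness). The answer need not be the string
  of the assumed proof, so the contradiction concerns the answer. The obstacle is that proof search
  must be an actual \<open>recf\<close>, including de Bruijn lifting and substitution. These
  operations therefore become relations on codes given by clauses, and only the generic clause
  search has to be shown computable.\<close>

text \<open>Serves both de Bruijn operations: \<open>lift_fm k\<close> makes a formula skip the
  inserted slot, and \<open>subst_fm k u\<close> amounts to inserting the value of
  \<open>u\<close>.\<close>

definition ins :: "nat \<Rightarrow> 'a \<Rightarrow> (nat \<Rightarrow> 'a) \<Rightarrow> nat \<Rightarrow> 'a" where
  "ins k x e = (\<lambda>i. if i < k then e i else if i = k then x else e (i - 1))"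

primrec val :: "(nat \<Rightarrow> nat) \<Rightarrow> tm \<Rightarrow> nat" where
  "val e (Var i) = e i"
| "val e Zr = 0"
| "val e (Sc t) = Suc (val e t)"
| "val e (Add s t) = val e s + val e t"
| "val e (Mul s t) = val e s * val e t"

primrec sat :: "(nat \<Rightarrow> nat) \<Rightarrow> fm \<Rightarrow> bool" where
  "sat e Fls = False"
| "sat e (Eq s t) = (val e s = val e t)"
| "sat e (Imp \<phi> \<psi>) = (sat e \<phi> \<longrightarrow> sat e \<psi>)"
| "sat e (Forall \<phi>) = (\<forall>x. sat (ins 0 x e) \<phi>)"

lemma ins_0 [simp]: "ins 0 x e 0 = x"
  by (simp add: ins_def)

lemma ins_Suc [simp]: "ins 0 x e (Suc i) = e i"
  by (simp add: ins_def)

lemma ins_numeral [simp]: "ins 0 x e (numeral k) = e (pred_numeral k)"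
  by (simp add: numeral_eq_Suc)

lemma ins_1 [simp]: "ins 0 x e (Suc 0) = e 0"
  by (simp add: ins_def)

lemma ins_ins: "ins (Suc k) y (ins 0 x e) = ins 0 x (ins k y e)"
  by (auto simp: ins_def fun_eq_iff)

lemma val_lift: "val (ins k x e) (lift_tm k t) = val e t"
  by (induction t) (auto simp: ins_def)

lemma sat_lift: "sat (ins k x e) (lift_fm k \<phi>) = sat e \<phi>"
proof (induction \<phi> arbitrary: k e)
  case (Forall \<phi>)
  have "sat (ins 0 y (ins k x e)) (lift_fm (Suc k) \<phi>) = sat (ins 0 y e) \<phi>" for y
    using Forall[of "Suc k" "ins 0 y e"] by (simp add: ins_ins)
  then show ?case by simp
qed (auto simp: val_lift)

lemma val_subst: "val e (subst_tm k u t) = val (ins k (val e u) e) t"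
  by (induction t) (auto simp: ins_def)

lemma sat_subst: "sat e (subst_fm k u \<phi>) = sat (ins k (val e u) e) \<phi>"
proof (induction \<phi> arbitrary: k u e)
  case (Forall \<phi>)
  have "sat (ins 0 y e) (subst_fm (Suc k) (lift_tm 0 u) \<phi>)
      = sat (ins 0 y (ins k (val e u) e)) \<phi>" for y
    using Forall[of "ins 0 y e" "Suc k" "lift_tm 0 u"] by (simp add: ins_ins val_lift)
  then show ?case by simp
qed (auto simp: val_subst)

lemma val_numeral [simp]: "val e (numeral_tm n) = n"
  by (induction n) auto

lemmas val_lift_0 [simp] = val_lift[where k = 0]

text \<open>The axioms must hold in every environment, not just in \<open>e\<close>, because
  \<open>Gen\<close> quantifies over their free variables.\<close>

lemma soundness:
  assumes "T \<turnstile> \<phi>" and "\<And>\<psi> e. \<psi> \<in> T \<Longrightarrow> sat e \<psi>"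
  shows "sat e \<phi>"
  using assms
proof (induction arbitrary: e rule: provable.induct)
  case (Inst \<phi> t)
  show ?case by (simp add: sat_subst)
next
  case (Vac \<phi>)
  show ?case by (simp add: sat_lift)
next
  case (Leibniz s t \<phi>)
  show ?case by (simp add: sat_subst)
qed auto

lemma sat_induction_axiom: "sat e (induction_axiom \<phi>)"
proof -
  \<comment> \<open>After the substitution the old value \<open>x\<close> sits at index 1, exactly
    the slot that \<open>lift_fm 1\<close> makes the formula skip.\<close>
  have "ins 0 (Suc x) (ins 0 x e) = ins 1 x (ins 0 (Suc x) e)" for x
    by (auto simp: ins_def fun_eq_iff)
  then have step: "sat (ins 0 x e) (subst_fm 0 (Sc (Var 0)) (lift_fm 1 \<phi>)) = sat (ins 0 (Suc x) e) \<phi>" for x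
    using sat_lift[of 1] by (simp add: sat_subst)
  have "sat (ins 0 x e) \<phi>" if "sat (ins 0 0 e) \<phi>"
    and "\<And>x. sat (ins 0 x e) \<phi> \<longrightarrow> sat (ins 0 (Suc x) e) \<phi>" for x
    using that by (induction x) auto
  then have "sat (ins 0 0 e) \<phi> \<longrightarrow> (\<forall>x. sat (ins 0 x e) \<phi> \<longrightarrow> sat (ins 0 (Suc x) e) \<phi>)
      \<longrightarrow> (\<forall>x. sat (ins 0 x e) \<phi>)"
    by iprover
  then show ?thesis
    unfolding induction_axiom_def sat.simps step by (simp only: sat_subst val.simps)
qed

lemma sat_PA: "\<phi> \<in> PA \<Longrightarrow> sat e \<phi>"
  unfolding PA_def by (auto simp: sat_induction_axiom)

lemma sat_Le [simp]: "sat e (Le s t) \<longleftrightarrow> val e s \<le> val e t"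
  by (auto simp: Le_def le_iff_add eq_commute)

lemma sat_Lt [simp]: "sat e (Lt s t) \<longleftrightarrow> val e s < val e t"
  by (auto simp: Lt_def)

subsection \<open>The graph of a partial recursive function\<close>

text \<open>Goedel's argument: for b = N! the moduli 1 + (i + 1)b are pairwise coprime, since a
  common prime divides (j - i)b, hence b, hence 1. The Chinese remainder theorem then gives
  \<open>a\<close>.\<close>

lemma beta_lemma: "\<exists>a b. \<forall>i\<le>n. s i = a mod Suc (Suc i * b)" for s :: "nat \<Rightarrow> nat"
proof -
  \<comment> \<open>\<open>N\<close> is at least \<open>n\<close>, so that every j - i divides
    \<open>b\<close>, and at least every \<open>s i\<close>, so that every \<open>s i\<close> is
    smaller than its modulus.\<close>
  define N where "N = n + (\<Sum>i\<le>n. s i)"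
  define b :: nat where "b = fact N"
  have b: "s i \<le> b" if "i \<le> n" for i
  proof -
    have "s i \<le> (\<Sum>i\<le>n. s i)"
      using that by (intro member_le_sum) auto
    also have "\<dots> \<le> N" by (simp add: N_def)
    also have "\<dots> \<le> b" unfolding b_def by (rule fact_ge_self)
    finally show ?thesis .
  qed
  have "coprime (Suc (Suc i * b)) (Suc (Suc j * b))" if "i < j" "j \<le> n" for i j
  proof (rule ccontr)
    assume "\<not> ?thesis"
    then obtain p where p: "prime p" "p dvd Suc (Suc i * b)" "p dvd Suc (Suc j * b)"
      by (metis coprime_iff_gcd_eq_1 gcd_greatest_iff prime_factor_nat)
    have "p dvd Suc (Suc j * b) - Suc (Suc i * b)"
      using p by (intro dvd_diff_nat)
    also have "Suc (Suc j * b) - Suc (Suc i * b) = (j - i) * b"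
      by (simp add: diff_mult_distrib)
    finally have "p dvd (j - i) \<or> p dvd b"
      using p(1) prime_dvd_multD by blast
    moreover have "(j - i) dvd b"
      unfolding b_def using that by (intro dvd_fact) (auto simp: N_def)
      ultimately have "p dvd b" using dvd_trans by blast
    with p(2) have "p dvd 1"
      by (metis dvd_add_left_iff dvd_mult plus_1_eq_Suc)
    with p(1) show False by (meson not_prime_unit)
  qed
  then have "\<forall>i\<in>{..n}. \<forall>j\<in>{..n}. i \<noteq> j \<longrightarrow> coprime (Suc (Suc i * b)) (Suc (Suc j * b))"
    by (metis atMost_iff coprime_commute linorder_neqE_nat)
  then obtain a where a: "\<forall>i\<in>{..n}. [a = s i] (mod Suc (Suc i * b))"
    using chinese_remainder_nat[of "{..n}" "\<lambda>i. Suc (Suc i * b)" s] by auto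
  have "s i = a mod Suc (Suc i * b)" if "i \<le> n" for i
    using a b[OF that] that by (auto simp: cong_def)
  then show ?thesis by blast
qed

lemma sat_Beta [simp]:
  "sat e (Beta a b i y) \<longleftrightarrow> val e y = val e a mod Suc (Suc (val e i) * val e b)"
proof -
  have "(\<exists>q. m = q * Suc k + r) \<and> r < Suc k \<longleftrightarrow> r = m mod Suc k" for m k r :: nat
    by (metis div_mult_mod_eq mod_less mod_mult_self3 mod_less_divisor zero_less_Suc)
  from this[of "val e a" "Suc (val e i) * val e b" "val e y"] show ?thesis
    by (auto simp: Beta_def Let_def)
qed

definition env_append :: "'a list \<Rightarrow> (nat \<Rightarrow> 'a) \<Rightarrow> nat \<Rightarrow> 'a" where
  "env_append ys e = (\<lambda>i. if i < length ys then ys ! i else e (i - length ys))"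

lemma env_append_Cons: "env_append (y # ys) e = ins 0 y (env_append ys e)"
  by (auto simp: env_append_def ins_def fun_eq_iff nth_Cons')

lemma sat_Exists_funpow:
  "sat e ((Exists ^^ k) \<phi>) \<longleftrightarrow> (\<exists>ys. length ys = k \<and> sat (env_append ys e) \<phi>)"
proof (induction k arbitrary: \<phi>)
  case 0
  then show ?case by (simp add: env_append_def)
next
  case (Suc k)
  have "sat e ((Exists ^^ Suc k) \<phi>) \<longleftrightarrow>
      (\<exists>ys. length ys = k \<and> (\<exists>y. sat (env_append (y # ys) e) \<phi>))"
    unfolding funpow_Suc_right comp_def Suc.IH by (simp add: env_append_Cons)
  also have "\<dots> \<longleftrightarrow> (\<exists>zs. length zs = Suc k \<and> sat (env_append zs e) \<phi>)"
    unfolding length_Suc_conv by blast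
  finally show ?case .
qed

lemma val_lifts_append: "val (env_append ys e) (lifts (length ys) t) = val e t"
  by (induction ys) (auto simp: env_append_Cons, simp add: env_append_def)

text \<open>The arity makes \<open>hd\<close>, \<open>tl\<close> and indexing commute with the
  evaluation of the arguments. \<open>Graphs\<close> reads the intermediate results from the slots
  \<open>i\<close>, \<open>i + 1\<close>, ..., which the quantifier block of \<open>RComp\<close>
  fills.\<close>

lemma sat_Graph_aux:
  "has_arity f (length ts) \<Longrightarrow>
     sat e (Graph f ts t) \<longleftrightarrow> ev f (map (val e) ts) = Some (val e t)"
  "\<forall>g\<in>set gs. has_arity g (length ts) \<Longrightarrow>
     sat e (Graphs gs ts i) \<longleftrightarrow> (\<forall>j<length gs. ev (gs ! j) (map (val e) ts) = Some (e (i + j)))"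
proof (induction f ts t and gs ts i arbitrary: e and e rule: Graph_Graphs.induct)
  case (1 ts t)
  then show ?case by auto
next
  case (2 ts t)
  then show ?case by (cases ts) auto
next
  case (3 i ts t)
  then show ?case by auto
next
  case (4 f gs ts t)
  let ?k = "length gs" and ?xs = "map (val e) ts"
  have val: "val (env_append ys e) (lifts ?k u) = val e u" if "length ys = ?k" for ys u
    using that val_lifts_append by metis
  have Graphs: "sat (env_append ys e) (Graphs gs (map (lifts ?k) ts) 0)
      \<longleftrightarrow> (\<forall>j<?k. ev (gs ! j) ?xs = Some (ys ! j))" if "length ys = ?k" for ys
    using 4 that by (simp add: comp_def val) (simp add: env_append_def)
  have map: "map (val (env_append ys e)) (map Var [0..<?k]) = ys" if "length ys = ?k" for ys
    using that by (intro nth_equalityI) (auto simp: env_append_def)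
  have Graph: "sat (env_append ys e) (Graph f (map Var [0..<?k]) (lifts ?k t))
      \<longleftrightarrow> ev f ys = Some (val e t)" if "length ys = ?k" for ys
    using 4 that val[OF that, of t] map[OF that] by simp
  have "sat e (Graph (RComp f gs) ts t) \<longleftrightarrow> (\<exists>ys. length ys = ?k
      \<and> (\<forall>j<?k. ev (gs ! j) ?xs = Some (ys ! j)) \<and> ev f ys = Some (val e t))"
    by (simp add: Let_def sat_Exists_funpow Graphs Graph cong: conj_cong)
  also have "\<dots> \<longleftrightarrow> ev (RComp f gs) ?xs = Some (val e t)" (is "?L = ?R")
  proof
    assume ?L
    then obtain ys where ys: "length ys = ?k" "\<forall>j<?k. ev (gs ! j) ?xs = Some (ys ! j)"
      "ev f ys = Some (val e t)" by blast
    then have "map (\<lambda>g. the (ev g ?xs)) gs = ys"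
      using ys(1,2) by (intro nth_equalityI) simp_all
    moreover have "\<forall>g\<in>set gs. ev g ?xs \<noteq> None"
      using ys(2) by (auto simp: in_set_conv_nth)
    ultimately show ?R using ys(3) by auto
  next
    assume R: ?R
    then have "\<forall>g\<in>set gs. \<exists>y. ev g ?xs = Some y" by (auto split: if_splits)
    then have "\<forall>j<?k. ev (gs ! j) ?xs = Some (map (\<lambda>g. the (ev g ?xs)) gs ! j)"
      by fastforce
    moreover have "ev f (map (\<lambda>g. the (ev g ?xs)) gs) = Some (val e t)"
      using R by (simp split: if_splits)
    ultimately show ?L
      by (metis length_map)
  qed
  finally show ?case .
next
  case (5 f g ts t)
  define n where "n = val e (hd ts)"
  define ps where "ps = map (val e) (tl ts)"
  define R where "R = rec_nat (ev f ps) (\<lambda>i r. Option.bind r (\<lambda>u. ev g (i # u # ps)))"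
  have ts: "ts \<noteq> []" using 5 by auto
  have ev: "ev (RPrec f g) (map (val e) ts) = R n"
    using ts by (cases ts) (auto simp: R_def n_def ps_def)
  have "sat e (Graph (RPrec f g) ts t) \<longleftrightarrow> (\<exists>a b. ev f ps = Some (a mod Suc (Suc 0 * b))
      \<and> (\<forall>i<n. ev g (i # a mod Suc (Suc i * b) # ps) = Some (a mod Suc (Suc (Suc i) * b)))
      \<and> val e t = a mod Suc (Suc n * b))"
    using 5 by (simp add: numeral_eq_Suc comp_def ps_def n_def)
  also have "\<dots> \<longleftrightarrow> R n = Some (val e t)" (is "?L = ?R")
  proof
    assume ?L
    then obtain a b where base: "ev f ps = Some (a mod Suc (Suc 0 * b))"
      and step: "\<forall>i<n. ev g (i # a mod Suc (Suc i * b) # ps) = Some (a mod Suc (Suc (Suc i) * b))"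
      and t: "val e t = a mod Suc (Suc n * b)" by blast
    have "R i = Some (a mod Suc (Suc i * b))" if "i \<le> n" for i
      using that
    proof (induction i)
      case 0
      then show ?case using base by (simp add: R_def)
    next
      case (Suc i)
      have "R (Suc i) = Option.bind (R i) (\<lambda>u. ev g (i # u # ps))" by (simp add: R_def)
      then show ?case using Suc step by simp
    qed
    then show ?R using t by simp
  next
    assume R: ?R
    \<comment> \<open>Downward induction from \<open>n\<close>: an undefined value would propagate
      through \<open>Option.bind\<close> to \<open>R n\<close>.\<close>
    have defined: "R i \<noteq> None" if "i \<le> n" for i
      using that
    proof (induction rule: inc_induct)
      case base
      then show ?case using R by simp
    next
      case (step i)
      then show ?case by (cases "R i") (auto simp: R_def)
    qed
    obtain a b where ab: "\<forall>i\<le>n. the (R i) = a mod Suc (Suc i * b)"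
      using beta_lemma[of n "\<lambda>i. the (R i)"] by auto
    then have val: "R i = Some (a mod Suc (Suc i * b))" if "i \<le> n" for i
      using that defined[OF that] by (metis option.collapse)
    have "ev f ps = Some (a mod Suc (Suc 0 * b))"
      using val[of 0] by (simp add: R_def)
    moreover have "ev g (i # a mod Suc (Suc i * b) # ps) = Some (a mod Suc (Suc (Suc i) * b))"
      if "i < n" for i
    proof -
      have "R (Suc i) = Option.bind (R i) (\<lambda>u. ev g (i # u # ps))" by (simp add: R_def)
      then show ?thesis using that val[of i] val[of "Suc i"] by simp
    qed
    moreover have "val e t = a mod Suc (Suc n * b)"
      using val[of n] R by simp
    ultimately show ?L by blast
  qed
  finally show ?case unfolding ev .
next
  case (6 f ts t)
  let ?xs = "map (val e) ts" and ?y = "val e t"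
  have "sat e (Graph (RMin f) ts t) \<longleftrightarrow>
      ev f (?y # ?xs) = Some 0 \<and> (\<forall>z<?y. \<exists>w. ev f (z # ?xs) = Some (Suc w))"
    using 6 by (simp add: numeral_eq_Suc comp_def)
  also have "\<dots> \<longleftrightarrow> ev (RMin f) ?xs = Some ?y"
  proof -
    have "(LEAST y. ev f (y # ?xs) = Some 0) = y" 
      if "ev f (y # ?xs) = Some 0" "\<forall>z<y. \<exists>w. ev f (z # ?xs) = Some (Suc w)" for y
    proof (rule Least_equality)
      fix z assume "ev f (z # ?xs) = Some 0"
      with that(2) show "y \<le> z" by (metis leI option.inject nat.distinct(1))
    qed (rule that)
    then show ?thesis by auto
  qed
  finally show ?case .
next
  case (7 ts i)
  then show ?case by simp
next
  case (8 g gs ts i)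
  then show ?case by (simp add: All_less_Suc2)
qed

lemma sat_Graph [simp]:
  "has_arity f (length ts) \<Longrightarrow>
     sat e (Graph f ts t) \<longleftrightarrow> ev f (map (val e) ts) = Some (val e t)"
  by (rule sat_Graph_aux)

subsection \<open>Total recursive functions\<close>

text \<open>Hiding the program behind an existential lets closure rules on HOL functions establish
  the computability of the search predicate.\<close>

definition total_rec :: "nat \<Rightarrow> (nat list \<Rightarrow> nat) \<Rightarrow> bool" where
  "total_rec n f \<longleftrightarrow> (\<exists>F. has_arity F n \<and> (\<forall>xs. length xs = n \<longrightarrow> ev F xs = Some (f xs)))"

lemma total_rec_cong:
  assumes "total_rec n f" and "\<And>xs. length xs = n \<Longrightarrow> f xs = g xs"
  shows "total_rec n g"
proof -
  obtain F where "has_arity F n" "\<And>xs. length xs = n \<Longrightarrow> ev F xs = Some (f xs)"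
    using assms(1) unfolding total_rec_def by blast
  then show ?thesis
    unfolding total_rec_def using assms(2) by (intro exI[of _ F]) simp
qed

lemma total_rec_zero: "total_rec n (\<lambda>xs. 0)"
  unfolding total_rec_def by (rule exI[of _ RZero]) auto

lemma total_rec_nth: "i < n \<Longrightarrow> total_rec n (\<lambda>xs. xs ! i)"
  unfolding total_rec_def by (rule exI[of _ "RProj i"]) auto

lemma total_rec_comp:
  assumes f: "total_rec (length gs) f" and gs: "\<And>g. g \<in> set gs \<Longrightarrow> total_rec n g"
  shows "total_rec n (\<lambda>xs. f (map (\<lambda>g. g xs) gs))"
proof -
  obtain F where F: "has_arity F (length gs)"
    "\<And>xs. length xs = length gs \<Longrightarrow> ev F xs = Some (f xs)"
    using f unfolding total_rec_def by blast
  obtain G where G: "\<And>g. g \<in> set gs \<Longrightarrow> has_arity (G g) n"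
    "\<And>g xs. g \<in> set gs \<Longrightarrow> length xs = n \<Longrightarrow> ev (G g) xs = Some (g xs)"
    using gs unfolding total_rec_def by metis
  have "map (\<lambda>g. the (ev g xs)) (map G gs) = map (\<lambda>g. g xs) gs" if "length xs = n" for xs
    using G(2) that by simp
  then have "ev (RComp F (map G gs)) xs = Some (f (map (\<lambda>g. g xs) gs))" if "length xs = n" for xs
    using G(2) F(2) that by (auto simp del: map_map)
  then show ?thesis
    unfolding total_rec_def using F(1) G(1)
    by (intro exI[of _ "RComp F (map G gs)"]) auto
qed

lemma total_rec_comp1:
  assumes "total_rec 1 (\<lambda>xs. f (xs ! 0))" "total_rec n g"
  shows "total_rec n (\<lambda>xs. f (g xs))"
  using total_rec_comp[of "[g]" "\<lambda>xs. f (xs ! 0)" n] assms by simp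

lemma total_rec_comp2:
  assumes "total_rec 2 (\<lambda>xs. f (xs ! 0) (xs ! 1))" "total_rec n g" "total_rec n h"
  shows "total_rec n (\<lambda>xs. f (g xs) (h xs))"
  using total_rec_comp[of "[g, h]" "\<lambda>xs. f (xs ! 0) (xs ! 1)" n] assms
  by (auto simp: numeral_2_eq_2)

lemma total_rec_comp3:
  assumes "total_rec 3 (\<lambda>xs. f (xs ! 0) (xs ! 1) (xs ! 2))"
    and "total_rec n g" "total_rec n h" "total_rec n k"
  shows "total_rec n (\<lambda>xs. f (g xs) (h xs) (k xs))"
  using total_rec_comp[of "[g, h, k]" "\<lambda>xs. f (xs ! 0) (xs ! 1) (xs ! 2)" n] assms
  by (auto simp: numeral_3_eq_3)

lemma total_rec_reindex:
  assumes "total_rec (length js) f" "\<And>j. j \<in> set js \<Longrightarrow> j < n"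
  shows "total_rec n (\<lambda>xs. f (map ((!) xs) js))"
  using total_rec_comp[of "map (\<lambda>j xs. xs ! j) js" f n] assms
  by (auto simp: comp_def intro: total_rec_nth)

lemma total_rec_Suc: "total_rec n f \<Longrightarrow> total_rec n (\<lambda>xs. Suc (f xs))"
proof (rule total_rec_comp1[of Suc])
  show "total_rec 1 (\<lambda>xs. Suc (xs ! 0))"
    unfolding total_rec_def by (rule exI[of _ RSucc]) (auto simp: length_Suc_conv)
qed

lemma total_rec_const: "total_rec n (\<lambda>xs. k)"
  by (induction k) (auto intro: total_rec_zero total_rec_Suc)

text \<open>The bound \<open>b xs\<close> is put in front of the whole list \<open>xs\<close>, which
  stays available as parameters; the step function finds them from index 2 on, after the counter and
  the previous value.\<close>

lemma total_rec_rec_nat: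
  assumes f: "total_rec n f" and g: "total_rec (n + 2) (\<lambda>xs. g (xs ! 0) (xs ! 1) (drop 2 xs))"
    and b: "total_rec n b"
  shows "total_rec n (\<lambda>xs. rec_nat (f xs) (\<lambda>i u. g i u xs) (b xs))"
proof -
  obtain F where F: "has_arity F n" "\<And>xs. length xs = n \<Longrightarrow> ev F xs = Some (f xs)"
    using f unfolding total_rec_def by blast
  obtain G where G: "has_arity G (n + 2)"
    "\<And>xs. length xs = n + 2 \<Longrightarrow> ev G xs = Some (g (xs ! 0) (xs ! 1) (drop 2 xs))"
    using g unfolding total_rec_def by blast
  let ?r = "\<lambda>ys. rec_nat (f (tl ys)) (\<lambda>i u. g i u (tl ys)) (hd ys)"
  have "rec_nat (ev F xs) (\<lambda>i r. Option.bind r (\<lambda>u. ev G (i # u # xs))) m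
      = Some (rec_nat (f xs) (\<lambda>i u. g i u xs) m)" if "length xs = n" for xs m
    using that by (induction m) (auto simp: F G)
  then have "total_rec (Suc n) ?r"
    unfolding total_rec_def using F(1) G(1) by (intro exI[of _ "RPrec F G"]) auto
  moreover have "total_rec n g" if "g \<in> set (b # map (\<lambda>j xs. xs ! j) [0..<n])" for g
    using that b by (auto intro: total_rec_nth)
  ultimately have "total_rec n (\<lambda>xs. ?r (map (\<lambda>g. g xs) (b # map (\<lambda>j xs. xs ! j) [0..<n])))"
    by (intro total_rec_comp) simp_all
  then show ?thesis
  proof (rule total_rec_cong)
    fix xs :: "nat list" assume "length xs = n"
    then have "map (\<lambda>g. g xs) (b # map (\<lambda>j xs. xs ! j) [0..<n]) = b xs # xs"
      using map_nth[of xs] by (simp add: comp_def)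
    then show "?r (map (\<lambda>g. g xs) (b # map (\<lambda>j xs. xs ! j) [0..<n]))
        = rec_nat (f xs) (\<lambda>i u. g i u xs) (b xs)"
      by (simp only: list.sel)
  qed
qed

lemma total_rec_add:
  assumes "total_rec n f" "total_rec n g" shows "total_rec n (\<lambda>xs. f xs + g xs)"
proof -
  have "total_rec n (\<lambda>xs. rec_nat (f xs) (\<lambda>i u. Suc u) (g xs))"
    by (intro total_rec_rec_nat total_rec_Suc total_rec_nth assms) simp
  moreover have "rec_nat a (\<lambda>i u. Suc u) b = a + b" for a b by (induction b) auto
  ultimately show ?thesis by simp
qed

lemma total_rec_mult:
  assumes "total_rec n f" "total_rec n g" shows "total_rec n (\<lambda>xs. f xs * g xs)"
proof -
  have "total_rec 2 (\<lambda>xs. rec_nat 0 (\<lambda>i u. u + xs ! 0) (xs ! 1))"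
    by (intro total_rec_rec_nat total_rec_zero total_rec_add
          total_rec_cong[OF total_rec_nth[of 2]] total_rec_nth) auto
  moreover have "rec_nat 0 (\<lambda>i u. u + a) b = a * b" for a b :: nat by (induction b) auto
  ultimately have "total_rec 2 (\<lambda>xs. xs ! 0 * xs ! 1)" by simp
  then show ?thesis using assms by (rule total_rec_comp2)
qed

lemma total_rec_pred:
  assumes "total_rec n f" shows "total_rec n (\<lambda>xs. f xs - 1)"
proof -
  have "total_rec n (\<lambda>xs. rec_nat 0 (\<lambda>i u. i) (f xs))"
    by (intro total_rec_rec_nat total_rec_zero total_rec_nth assms) simp
  moreover have "rec_nat 0 (\<lambda>i u. i) b = b - 1" for b :: nat by (cases b) auto
  ultimately show ?thesis by simp
qed

lemma total_rec_diff:
  assumes "total_rec n f" "total_rec n g" shows "total_rec n (\<lambda>xs. f xs - g xs)"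
proof -
  have "total_rec n (\<lambda>xs. rec_nat (f xs) (\<lambda>i u. u - 1) (g xs))"
    by (intro total_rec_rec_nat total_rec_pred total_rec_nth assms) simp
  moreover have "rec_nat a (\<lambda>i u. u - 1) b = a - b" for a b :: nat by (induction b) auto
  ultimately show ?thesis by simp
qed

section \<open>Decidable predicates\<close>

text \<open>The value 0 means truth, so that \<open>RMin\<close> searches for a witness.\<close>

definition decidable :: "nat \<Rightarrow> (nat list \<Rightarrow> bool) \<Rightarrow> bool" where
  "decidable n P \<longleftrightarrow> total_rec n (\<lambda>xs. if P xs then 0 else 1)"

lemma total_rec_if:
  assumes "decidable n P" "total_rec n f" "total_rec n g"
  shows "total_rec n (\<lambda>xs. if P xs then f xs else g xs)"
proof -
  \<comment> \<open>The truth value is the number of recursion steps: none returns the first branch,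
    one replaces it by the second.\<close>
  have "total_rec 3 (\<lambda>xs. rec_nat (xs ! 1) (\<lambda>i u. xs ! 2) (xs ! 0))"
    by (intro total_rec_rec_nat total_rec_cong[OF total_rec_nth[of 4]] total_rec_nth) auto
  from total_rec_comp3[OF this assms(1)[unfolded decidable_def] assms(2,3)] show ?thesis
    by (rule total_rec_cong) auto
qed

lemma decidable_cong:
  assumes "decidable n P" and "\<And>xs. length xs = n \<Longrightarrow> P xs = Q xs"
  shows "decidable n Q"
  using assms(1) unfolding decidable_def by (rule total_rec_cong) (simp add: assms(2))

lemma decidable_const: "decidable n (\<lambda>xs. b)"
  unfolding decidable_def by (rule total_rec_const)

lemma decidable_not:
  assumes "decidable n P" shows "decidable n (\<lambda>xs. \<not> P xs)"
proof -
  have "total_rec n (\<lambda>xs. if P xs then 1 else 0)"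
    by (intro total_rec_if total_rec_const assms)
  then show ?thesis unfolding decidable_def by (rule total_rec_cong) simp
qed

lemma decidable_and:
  assumes "decidable n P" "decidable n Q" shows "decidable n (\<lambda>xs. P xs \<and> Q xs)"
proof -
  have "total_rec n (\<lambda>xs. if P xs then if Q xs then 0 else 1 else 1)"
    by (intro total_rec_if total_rec_const assms)
  then show ?thesis unfolding decidable_def by (rule total_rec_cong) simp
qed

lemma decidable_or:
  "decidable n P \<Longrightarrow> decidable n Q \<Longrightarrow> decidable n (\<lambda>xs. P xs \<or> Q xs)"
  using decidable_not[OF decidable_and[OF decidable_not[of n P] decidable_not[of n Q]]]
  by simp

lemma decidable_imp:
  "decidable n P \<Longrightarrow> decidable n Q \<Longrightarrow> decidable n (\<lambda>xs. P xs \<longrightarrow> Q xs)"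
  using decidable_or[OF decidable_not[of n P], of Q] by simp

lemma decidable_le:
  assumes "total_rec n f" "total_rec n g" shows "decidable n (\<lambda>xs. f xs \<le> g xs)"
proof -
  \<comment> \<open>With truncated subtraction this is 0 if the difference is 0, and 1
    otherwise.\<close>
  have "total_rec n (\<lambda>xs. 1 - (1 - (f xs - g xs)))"
    by (intro total_rec_diff total_rec_const assms)
  then show ?thesis unfolding decidable_def by (rule total_rec_cong) auto
qed

lemma decidable_less:
  assumes "total_rec n f" "total_rec n g" shows "decidable n (\<lambda>xs. f xs < g xs)"
  using decidable_le[OF total_rec_Suc[OF assms(1)] assms(2)] by (simp add: Suc_le_eq)

lemma decidable_eq:
  assumes "total_rec n f" "total_rec n g" shows "decidable n (\<lambda>xs. f xs = g xs)"
  using decidable_and[OF decidable_le[OF assms] decidable_le[OF assms(2,1)]]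
  by (rule decidable_cong) auto

lemma total_rec_Least:
  assumes P: "decidable (Suc n) (\<lambda>ys. P (hd ys) (tl ys))"
    and ex: "\<And>xs. length xs = n \<Longrightarrow> \<exists>y. P y xs"
  shows "total_rec n (\<lambda>xs. LEAST y. P y xs)"
proof -
  obtain F where F: "has_arity F (Suc n)"
    "\<And>ys. length ys = Suc n \<Longrightarrow> ev F ys = Some (if P (hd ys) (tl ys) then 0 else 1)"
    using P unfolding decidable_def total_rec_def by blast
  have "ev (RMin F) xs = Some (LEAST y. P y xs)" if xs: "length xs = n" for xs
  proof -
    have ev: "ev F (y # xs) = Some (if P y xs then 0 else 1)" for y using F xs by simp
    define m where "m = (LEAST y. P y xs)"
    have "P m xs" unfolding m_def using ex[OF xs] by (rule LeastI_ex)
    moreover have "\<not> P z xs" if "z < m" for z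
      using that unfolding m_def by (rule not_less_Least)
    ultimately have "\<exists>y. ev F (y # xs) = Some 0 \<and> (\<forall>z<y. \<exists>w. ev F (z # xs) = Some (Suc w))"
      by (intro exI[of _ m]) (simp add: ev)
    moreover have "(ev F (y # xs) = Some 0) = P y xs" for y by (simp add: ev)
    ultimately show ?thesis by simp
  qed
  then show ?thesis unfolding total_rec_def using F(1)
    by (intro exI[of _ "RMin F"]) auto
qed

lemma decidable_ex_less:
  assumes P: "decidable (Suc n) (\<lambda>ys. P (hd ys) (tl ys))" and b: "total_rec n b"
  shows "decidable n (\<lambda>xs. \<exists>y<b xs. P y xs)"
proof -
  \<comment> \<open>The step function of the recursion also receives the previous value at index 1;
    reindexing hides it from \<open>P\<close>.\<close>
  have "map ((!) zs) (0 # [2..<n + 2]) = zs ! 0 # drop 2 zs" if "length zs = n + 2"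
    for zs :: "nat list"
    using that by (auto intro: nth_equalityI simp del: upt_Suc)
  moreover have "length (0 # [2..<n + 2]) = Suc n" by (simp del: upt_Suc)
  then have "total_rec (n + 2) (\<lambda>zs. if P (hd (map ((!) zs) (0 # [2..<n + 2])))
      (tl (map ((!) zs) (0 # [2..<n + 2]))) then 0 else 1)"
    using P unfolding decidable_def by (intro total_rec_reindex) (simp_all del: upt_Suc, auto)
  ultimately have "total_rec (n + 2) (\<lambda>zs. if P (zs ! 0) (drop 2 zs) then 0 else 1)"
    by (elim total_rec_cong) simp
  then have "decidable (n + 2) (\<lambda>zs. P (zs ! 0) (drop 2 zs))"
    unfolding decidable_def .
  then have "total_rec n (\<lambda>xs. rec_nat 1 (\<lambda>i u. if P i xs then 0 else u) (b xs))"
    by (intro total_rec_rec_nat total_rec_if total_rec_const total_rec_nth b) auto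
  moreover have "rec_nat 1 (\<lambda>i u. if P i xs then 0 else u) m = (if \<exists>y<m. P y xs then 0 else 1 :: nat)"
    for m xs
    by (induction m) (auto simp: less_Suc_eq)
  ultimately show ?thesis unfolding decidable_def by simp
qed

lemma decidable_all_less:
  assumes P: "decidable (Suc n) (\<lambda>ys. P (hd ys) (tl ys))" and b: "total_rec n b"
  shows "decidable n (\<lambda>xs. \<forall>y<b xs. P y xs)"
  using decidable_not[OF decidable_ex_less[OF decidable_not[OF P] b]] by simp

lemma decidable_comp2:
  assumes "decidable 2 (\<lambda>xs. P (xs ! 0) (xs ! 1))" "total_rec n g" "total_rec n h"
  shows "decidable n (\<lambda>xs. P (g xs) (h xs))"
  using assms unfolding decidable_def by (rule total_rec_comp2)

lemma decidable_comp3: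
  assumes "decidable 3 (\<lambda>xs. P (xs ! 0) (xs ! 1) (xs ! 2))"
    and "total_rec n g" "total_rec n h" "total_rec n k"
  shows "decidable n (\<lambda>xs. P (g xs) (h xs) (k xs))"
  using assms unfolding decidable_def by (rule total_rec_comp3)

section \<open>Parity, binary digits and the inverse of the pairing function\<close>

lemma total_rec_mod2:
  assumes "total_rec n f" shows "total_rec n (\<lambda>xs. f xs mod 2)"
proof -
  have "total_rec n (\<lambda>xs. rec_nat 0 (\<lambda>i u. 1 - u) (f xs))"
    by (intro total_rec_rec_nat total_rec_const total_rec_diff total_rec_nth assms) auto
  moreover have "rec_nat 0 (\<lambda>i u. 1 - u) m = m mod 2" for m :: nat
    by (induction m) (simp_all add: mod_Suc)
  ultimately show ?thesis by simp
qed

lemma total_rec_div2: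
  assumes "total_rec n f" shows "total_rec n (\<lambda>xs. f xs div 2)"
proof -
  \<comment> \<open>Passing from i to i + 1 raises the half exactly when i is odd.\<close>
  have "total_rec n (\<lambda>xs. rec_nat 0 (\<lambda>i u. u + i mod 2) (f xs))"
    by (intro total_rec_rec_nat total_rec_const total_rec_add total_rec_mod2 total_rec_nth assms) auto
  moreover have "rec_nat 0 (\<lambda>i u. u + i mod 2) m = m div 2" for m :: nat
    by (induction m) (simp, simp, presburger)
  ultimately show ?thesis by simp
qed

lemma decidable_set_decode:
  assumes "total_rec n f" "total_rec n g" shows "decidable n (\<lambda>xs. f xs \<in> set_decode (g xs))"
proof -
  have "total_rec n (\<lambda>xs. rec_nat (g xs) (\<lambda>i u. u div 2) (f xs))"
    by (intro total_rec_rec_nat total_rec_div2 total_rec_nth assms) auto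
  moreover have "rec_nat a (\<lambda>i u. u div 2) m = a div 2 ^ m" for a m :: nat
    by (induction m) (simp_all add: div_mult2_eq[symmetric] mult.commute)
  ultimately have "total_rec n (\<lambda>xs. g xs div 2 ^ f xs)" by simp
  then have "decidable n (\<lambda>xs. g xs div 2 ^ f xs mod 2 = 1)"
    by (intro decidable_eq total_rec_mod2 total_rec_const)
  then show ?thesis by (simp add: set_decode_def odd_iff_mod_2_eq_one)
qed

lemma total_rec_triangle:
  assumes "total_rec n f" shows "total_rec n (\<lambda>xs. triangle (f xs))"
proof -
  have "total_rec n (\<lambda>xs. (f xs * Suc (f xs)) div 2)"
    by (intro total_rec_div2 total_rec_mult total_rec_Suc assms)
  then show ?thesis by (simp add: triangle_def)
qed

lemma total_rec_prod_encode:
  assumes "total_rec n f" "total_rec n g" shows "total_rec n (\<lambda>xs. prod_encode (f xs, g xs))"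
  unfolding prod_encode_def split by (intro total_rec_add total_rec_triangle assms)

definition pfst :: "nat \<Rightarrow> nat" where "pfst z = fst (prod_decode z)"
definition psnd :: "nat \<Rightarrow> nat" where "psnd z = snd (prod_decode z)"

lemma pfst_encode [simp]: "pfst (prod_encode (a, b)) = a"
  and psnd_encode [simp]: "psnd (prod_encode (a, b)) = b"
  by (simp_all add: pfst_def psnd_def)

lemma prod_encode_pfst_psnd [simp]: "prod_encode (pfst z, psnd z) = z"
  by (simp add: pfst_def psnd_def)

lemma triangle_mono: "a \<le> b \<Longrightarrow> triangle a \<le> triangle b"
  by (induction b) (auto simp: le_Suc_eq)

text \<open>Cantor pairing puts (a, b) at position a on the diagonal s = a + b, that is, z =
  triangle s + a with a \<le> s. The diagonal is thus found by minimization, and both coordinates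
  follow by subtraction.\<close>

lemma pfst_psnd_sum: "pfst z + psnd z = (LEAST s. z < triangle (Suc s))"
proof (rule sym, rule Least_equality)
  have z: "z = triangle (pfst z + psnd z) + pfst z"
    using prod_encode_pfst_psnd[of z] by (simp add: prod_encode_def)
  then show "z < triangle (Suc (pfst z + psnd z))" by simp
  fix s assume s: "z < triangle (Suc s)"
  show "pfst z + psnd z \<le> s"
  proof (rule ccontr)
    assume "\<not> ?thesis"
    then have "triangle (Suc s) \<le> triangle (pfst z + psnd z)" by (intro triangle_mono) simp
    with s z show False by linarith
  qed
qed

lemma total_rec_pfst_psnd:
  assumes "total_rec n f"
  shows total_rec_pfst: "total_rec n (\<lambda>xs. pfst (f xs))"
    and total_rec_psnd: "total_rec n (\<lambda>xs. psnd (f xs))"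
proof -
  have "total_rec 1 (\<lambda>xs. LEAST s. xs ! 0 < triangle (Suc s))"
  proof (rule total_rec_Least)
    have "decidable 2 (\<lambda>xs. xs ! 1 < triangle (Suc (xs ! 0)))"
      by (intro decidable_less total_rec_triangle total_rec_Suc total_rec_nth) auto
    then show "decidable (Suc 1) (\<lambda>ys. tl ys ! 0 < triangle (Suc (hd ys)))"
      unfolding numeral_2_eq_2 One_nat_def
      by (rule decidable_cong) (auto simp: length_Suc_conv)
    have "xs ! 0 < triangle (Suc (xs ! 0))" for xs :: "nat list" by simp
    then show "\<exists>s. xs ! 0 < triangle (Suc s)" for xs :: "nat list" by blast
  qed
  then have sum: "total_rec 1 (\<lambda>xs. pfst (xs ! 0) + psnd (xs ! 0))"
    unfolding pfst_psnd_sum .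
  have "z = triangle (pfst z + psnd z) + pfst z" for z
    using prod_encode_pfst_psnd[of z] by (simp add: prod_encode_def)
  then have fst: "pfst z = z - triangle (pfst z + psnd z)"
    and snd: "psnd z = (pfst z + psnd z) - (z - triangle (pfst z + psnd z))" for z
    by (metis diff_add_inverse)+
  have "total_rec 1 (\<lambda>xs. pfst (xs ! 0))"
    by (subst fst) (intro total_rec_diff total_rec_triangle sum total_rec_nth, simp)
  then show "total_rec n (\<lambda>xs. pfst (f xs))"
    using assms by (rule total_rec_comp1)
  have "total_rec 1 (\<lambda>xs. psnd (xs ! 0))"
    by (subst snd) (intro total_rec_diff total_rec_triangle sum total_rec_nth, simp)
  then show "total_rec n (\<lambda>xs. psnd (f xs))"
    using assms by (rule total_rec_comp1)
qed

subsection \<open>Horn clauses over natural numbers\<close>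

text \<open>Clauses are applied by guessing an assignment and evaluating, never by matching, so a
  non-injective operation such as \<open>PAdd\<close> is harmless.\<close>

datatype pat = PV nat | PC nat | PS pat | PAdd pat pat | PP pat pat

primrec peval :: "(nat \<Rightarrow> nat) \<Rightarrow> pat \<Rightarrow> nat" where
  "peval \<sigma> (PV i) = \<sigma> i"
| "peval \<sigma> (PC n) = n"
| "peval \<sigma> (PS p) = Suc (peval \<sigma> p)"
| "peval \<sigma> (PAdd p q) = peval \<sigma> p + peval \<sigma> q"
| "peval \<sigma> (PP p q) = prod_encode (peval \<sigma> p, peval \<sigma> q)"

primrec pbound :: "pat \<Rightarrow> nat" where
  "pbound (PV i) = Suc i"
| "pbound (PC n) = 0"
| "pbound (PS p) = pbound p"
| "pbound (PAdd p q) = pbound p + pbound q"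
| "pbound (PP p q) = pbound p + pbound q"

lemma peval_cong: "(\<And>i. i < pbound p \<Longrightarrow> \<sigma> i = \<tau> i) \<Longrightarrow> peval \<sigma> p = peval \<tau> p"
  by (induction p) auto

type_synonym clause = "pat list \<times> pat"

inductive horn :: "clause set \<Rightarrow> nat \<Rightarrow> bool" for R where
  "(ps, c) \<in> R \<Longrightarrow> (\<And>p. p \<in> set ps \<Longrightarrow> horn R (peval \<sigma> p)) \<Longrightarrow> horn R (peval \<sigma> c)"

text \<open>Reads \<open>e\<close> as an endless nested pair. Every number thus codes an assignment
  to all variables, and no well-formedness has to be checked.\<close>

definition proj :: "nat \<Rightarrow> nat \<Rightarrow> nat" where
  "proj e i = pfst ((psnd ^^ i) e)"

lemma total_rec_peval:
  assumes "total_rec n f" shows "total_rec n (\<lambda>xs. peval (proj (f xs)) p)"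
proof (induction p)
  case (PV i)
  have "total_rec n (\<lambda>xs. (psnd ^^ i) (f xs))"
    by (induction i) (auto intro: assms total_rec_psnd)
  then show ?case by (auto simp: proj_def intro: total_rec_pfst)
qed (auto intro: total_rec_const total_rec_Suc total_rec_add total_rec_prod_encode)

text \<open>The tail left after \<open>k\<close> projections is arbitrary; starting from
  \<open>N\<close> makes the code large, as pairing never falls below its components.\<close>

lemma ex_proj: "\<exists>e\<ge>N. \<forall>i<k. proj e i = \<sigma> i"
proof (induction k arbitrary: \<sigma>)
  case 0
  then show ?case by auto
next
  case (Suc k)
  obtain e where e: "e \<ge> N" "\<forall>i<k. proj e i = \<sigma> (Suc i)"
    using Suc[of "\<lambda>i. \<sigma> (Suc i)"] by blast
  have "proj (prod_encode (\<sigma> 0, e)) i = \<sigma> i" if "i < Suc k" for i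
    using that e(2) by (cases i) (simp_all add: proj_def funpow_Suc_right del: funpow.simps)
  moreover have "N \<le> prod_encode (\<sigma> 0, e)"
    using e(1) le_prod_encode_2 le_trans by blast
  ultimately show ?case by blast
qed

text \<open>A derivation is a finite set of numbers \<open>z = (e, x)\<close>, where \<open>x\<close> is a derived fact and \<open>e\<close>
  encodes the assignment of the last clause applied. The part of \<open>e\<close> that no variable uses is
  padding, which makes \<open>z\<close> larger than the entries of the premises.\<close>

definition justified :: "clause list \<Rightarrow> nat set \<Rightarrow> nat \<Rightarrow> bool" where
  "justified rs W z \<longleftrightarrow> (\<exists>(ps, c)\<in>set rs. psnd z = peval (proj (pfst z)) c
     \<and> (\<forall>p\<in>set ps. \<exists>y<z. y \<in> W \<and> psnd y = peval (proj (pfst z)) p))"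

lemma justified_mono: "justified rs V z \<Longrightarrow> V \<subseteq> W \<Longrightarrow> justified rs W z"
  unfolding justified_def by (fastforce simp: split_beta)

text \<open>Premises are smaller numbers than the entry they justify, which rules out circular
  support and permits induction.\<close>

lemma horn_if_justified:
  assumes "\<forall>z\<in>W. justified rs W z" "z \<in> W" shows "horn (set rs) (psnd z)"
  using assms(2)
proof (induction z rule: less_induct)
  case (less z)
  then obtain ps c where c: "(ps, c) \<in> set rs" "psnd z = peval (proj (pfst z)) c"
    and ps: "\<forall>p\<in>set ps. \<exists>y<z. y \<in> W \<and> psnd y = peval (proj (pfst z)) p"
    using assms(1) by (auto simp: justified_def)
  have "horn (set rs) (peval (proj (pfst z)) p)" if "p \<in> set ps" for p
    using ps that less.IH by metis
  then show ?case
    unfolding c(2) using c(1) by (rule horn.intros[rotated])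
qed

lemma justified_if_horn:
  assumes "horn (set rs) x"
  shows "\<exists>W. finite W \<and> (\<forall>z\<in>W. justified rs W z) \<and> x \<in> psnd ` W"
  using assms
proof (induction rule: horn.induct)
  case (1 ps c \<sigma>)
  then obtain V where V: "\<And>p. p \<in> set ps \<Longrightarrow> finite (V p)"
    "\<And>p z. p \<in> set ps \<Longrightarrow> z \<in> V p \<Longrightarrow> justified rs (V p) z"
    "\<And>p. p \<in> set ps \<Longrightarrow> peval \<sigma> p \<in> psnd ` V p"
    by metis
  define U where "U = (\<Union>p\<in>set ps. V p)"
  define k where "k = pbound c + sum_list (map pbound ps)"
  have "finite U" using V(1) by (simp add: U_def)
  then obtain N where N: "\<forall>y\<in>U. y < N" using finite_nat_set_iff_bounded by blast
  \<comment> \<open>The assignment is copied on the variables of the clause only; the padding lifts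
    the new entry above all entries of the subderivations.\<close>
  obtain e where e: "e \<ge> N" "\<forall>i<k. proj e i = \<sigma> i" using ex_proj by blast
  have c: "peval (proj e) c = peval \<sigma> c"
    using e(2) by (intro peval_cong) (simp add: k_def)
  have p: "peval (proj e) p = peval \<sigma> p" if "p \<in> set ps" for p
  proof (rule peval_cong)
    fix i assume "i < pbound p"
    also have "pbound p \<le> k"
      using member_le_sum_list[of "pbound p" "map pbound ps"] that by (simp add: k_def)
    finally show "proj e i = \<sigma> i" using e(2) by blast
  qed
  define z where "z = prod_encode (e, peval \<sigma> c)"
  have z: "y < z" if "y \<in> U" for y
    using N e(1) that le_prod_encode_1[of e "peval \<sigma> c"] by (fastforce simp: z_def)
  have "\<exists>y<z. y \<in> insert z U \<and> psnd y = peval \<sigma> p" if "p \<in> set ps" for p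
    using V(3)[OF that] that z by (fastforce simp: U_def)
  then have "justified rs (insert z U) z"
    unfolding justified_def using 1(1) c p by (intro bexI[of _ "(ps, c)"]) (auto simp: z_def)
  moreover have "justified rs (insert z U) y" if "y \<in> U" for y
    using that V(2) justified_mono[of rs _ y "insert z U"] by (auto simp: U_def)
  ultimately show ?case
    using \<open>finite U\<close> by (intro exI[of _ "insert z U"]) (auto simp: z_def)
qed

text \<open>The derivation is the set of binary digits of \<open>w\<close>. Its members are below
  \<open>w\<close>, so bounding the quantifiers by \<open>w\<close> loses nothing and makes the
  predicate decidable.\<close>

definition certifies :: "clause list \<Rightarrow> nat \<Rightarrow> nat \<Rightarrow> bool" where
  "certifies rs w x \<longleftrightarrow> (\<forall>z<w. z \<in> set_decode w \<longrightarrow> justified rs (set_decode w) z)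
     \<and> (\<exists>z<w. z \<in> set_decode w \<and> psnd z = x)"

lemma set_decode_less:
  assumes "z \<in> set_decode w" shows "z < w"
proof -
  have "w div 2 ^ z \<noteq> 0" using assms by (metis even_zero mem_Collect_eq set_decode_def)
  then have "2 ^ z \<le> w" by (meson div_less not_le)
  then show ?thesis using less_exp[of z] by linarith
qed

lemma horn_iff_certifies: "horn (set rs) x \<longleftrightarrow> (\<exists>w. certifies rs w x)"
proof
  assume "horn (set rs) x"
  then obtain W where W: "finite W" "\<forall>z\<in>W. justified rs W z" "x \<in> psnd ` W"
    using justified_if_horn[of rs x] by blast
  from W(1) have decode: "set_decode (set_encode W) = W" by (rule set_encode_inverse)
  have "z < set_encode W" if "z \<in> W" for z
    using set_decode_less[of z "set_encode W"] that decode by simp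
  then have "certifies rs (set_encode W) x"
    using W(2,3) unfolding certifies_def decode by blast
  then show "\<exists>w. certifies rs w x" by blast
next
  assume "\<exists>w. certifies rs w x"
  then show "horn (set rs) x"
    unfolding certifies_def using horn_if_justified set_decode_less by metis
qed

lemma decidable_list_all:
  "(\<And>a. a \<in> set as \<Longrightarrow> decidable n (P a)) \<Longrightarrow> decidable n (\<lambda>xs. \<forall>a\<in>set as. P a xs)"
  by (induction as) (simp_all add: decidable_const decidable_and)

lemma decidable_list_ex:
  "(\<And>a. a \<in> set as \<Longrightarrow> decidable n (P a)) \<Longrightarrow> decidable n (\<lambda>xs. \<exists>a\<in>set as. P a xs)"
  by (induction as) (simp_all add: decidable_const decidable_or)

lemma decidable_certifies:
  assumes "total_rec n f" "total_rec n g"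
  shows "decidable n (\<lambda>xs. certifies rs (f xs) (g xs))"
proof -
  have "decidable 3 (\<lambda>xs. \<exists>y<xs ! 0. y \<in> set_decode (xs ! 1) \<and> psnd y = xs ! 2)"
  proof (rule decidable_ex_less)
    have "decidable (Suc 3) (\<lambda>ys. ys ! 0 \<in> set_decode (ys ! 2) \<and> psnd (ys ! 0) = ys ! 3)"
      by (intro decidable_and decidable_set_decode decidable_eq total_rec_psnd total_rec_nth) auto
    then show "decidable (Suc 3) (\<lambda>ys. hd ys \<in> set_decode (tl ys ! 1) \<and> psnd (hd ys) = tl ys ! 2)"
      by (rule decidable_cong) (auto simp: numeral_eq_Suc length_Suc_conv)
  qed (simp add: total_rec_nth)
  note supported = decidable_comp3[OF this]
  have "decidable 2 (\<lambda>xs. justified rs (set_decode (xs ! 1)) (xs ! 0))"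
    unfolding justified_def split_beta
    by (intro decidable_list_ex decidable_and decidable_list_all decidable_eq supported
          total_rec_peval total_rec_pfst total_rec_psnd total_rec_nth) auto
  note justified = decidable_comp2[OF this]
  have "decidable 1 (\<lambda>xs. \<forall>z<xs ! 0. z \<in> set_decode (xs ! 0) \<longrightarrow> justified rs (set_decode (xs ! 0)) z)"
  proof (rule decidable_all_less)
    have "decidable 2 (\<lambda>ys. ys ! 0 \<in> set_decode (ys ! 1) \<longrightarrow> justified rs (set_decode (ys ! 1)) (ys ! 0))"
      by (intro decidable_imp decidable_set_decode justified total_rec_nth) auto
    then show "decidable (Suc 1) (\<lambda>ys. hd ys \<in> set_decode (tl ys ! 0) \<longrightarrow>
        justified rs (set_decode (tl ys ! 0)) (hd ys))"
      unfolding numeral_2_eq_2 One_nat_def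
      by (rule decidable_cong) (auto simp: length_Suc_conv)
  qed (simp add: total_rec_nth)
  then have "decidable n (\<lambda>xs. \<forall>z<f xs. z \<in> set_decode (f xs) \<longrightarrow> justified rs (set_decode (f xs)) z)"
    using assms(1) unfolding decidable_def by (rule total_rec_comp1)
  then show ?thesis
    unfolding certifies_def by (intro decidable_and supported assms)
qed

text \<open>Minimization runs over pairs of a certificate and an answer. The answer found may differ
  from the one known to exist, hence the separate clause on termination.\<close>

lemma horn_search:
  assumes "finite R"
  shows "\<exists>F. has_arity F 1
    \<and> (\<forall>p y. ev F [p] = Some y \<longrightarrow> horn R (prod_encode (k, prod_encode (p, y))))
    \<and> (\<forall>p y. horn R (prod_encode (k, prod_encode (p, y))) \<longrightarrow> ev F [p] \<noteq> None)"
proof -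
  obtain rs where rs: "R = set rs" using finite_list[OF assms] by blast
  define P where "P = (\<lambda>v p. certifies rs (pfst v) (prod_encode (k, prod_encode (p, psnd v))))"
  have "decidable 2 (\<lambda>xs. P (xs ! 0) (xs ! 1))"
    unfolding P_def by (intro decidable_certifies total_rec_prod_encode total_rec_const
        total_rec_pfst total_rec_psnd total_rec_nth) auto
  then obtain G where G: "has_arity G 2"
    "\<And>v p. ev G [v, p] = Some (if P v p then 0 else 1)"
    unfolding decidable_def total_rec_def by force
  have "total_rec 1 (\<lambda>xs. psnd (xs ! 0))"
    by (intro total_rec_psnd total_rec_nth) simp
  then obtain H where H: "has_arity H 1" "\<And>v. ev H [v] = Some (psnd v)"
    unfolding total_rec_def by force
  define F where "F = RComp H [RMin G]"
  have P_iff: "(\<exists>v. P v p \<and> psnd v = y) \<longleftrightarrow> horn R (prod_encode (k, prod_encode (p, y)))" for p y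
  proof -
    have "(\<exists>v. P v p \<and> psnd v = y) \<longleftrightarrow> (\<exists>w. certifies rs w (prod_encode (k, prod_encode (p, y))))"
      unfolding P_def by (metis pfst_encode psnd_encode)
    then show ?thesis by (simp add: rs horn_iff_certifies)
  qed
  have min: "ev (RMin G) [p] = (if \<exists>v. P v p then Some (LEAST v. P v p) else None)" for p
  proof -
    have "(\<exists>v. P v p \<and> (\<forall>z<v. \<not> P z p)) \<longleftrightarrow> (\<exists>v. P v p)"
      using exists_least_iff[of "\<lambda>v. P v p"] by blast
    moreover have "(ev G [v, p] = Some 0) = P v p" "(\<exists>w. ev G [v, p] = Some (Suc w)) = (\<not> P v p)" for v
      by (simp_all add: G(2))
    ultimately show ?thesis by simp
  qed
  have ev: "ev F [p] = (if \<exists>v. P v p then Some (psnd (LEAST v. P v p)) else None)" for p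
    using H(2) min unfolding F_def by simp
  have "has_arity F 1" using G(1) H(1) by (simp add: F_def numeral_2_eq_2)
  moreover have "horn R (prod_encode (k, prod_encode (p, y)))" if "ev F [p] = Some y" for p y
    using that LeastI_ex[of "\<lambda>v. P v p"] P_iff unfolding ev by (metis option.distinct(1) option.inject)
  moreover have "ev F [p] \<noteq> None" if "horn R (prod_encode (k, prod_encode (p, y)))" for p y
    using that P_iff unfolding ev by (metis option.distinct(1))
  ultimately show ?thesis by blast
qed

subsection \<open>Substitution in the graph formulas\<close>

lemma subst_lift_tm:
  "subst_tm (Suc k) (lift_tm 0 u) (lift_tm 0 t) = lift_tm 0 (subst_tm k u t)"
  by (induction t) auto

lemma subst_lifts:
  "subst_tm (j + k) (lifts k u) (lifts k t) = lifts k (subst_tm j u t)"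
  by (induction k) (simp_all add: subst_lift_tm)

lemma subst_Exists_funpow:
  "subst_fm j u ((Exists ^^ k) \<phi>) = (Exists ^^ k) (subst_fm (j + k) (lifts k u) \<phi>)"
  by (induction k arbitrary: j u) (simp_all add: funpow_swap1)

lemma subst_Le: "subst_fm j u (Le s t) = Le (subst_tm j u s) (subst_tm j u t)"
  by (simp add: Le_def subst_lift_tm)

lemma subst_Lt: "subst_fm j u (Lt s t) = Lt (subst_tm j u s) (subst_tm j u t)"
  by (simp add: Lt_def subst_Le)

lemma subst_Beta: "subst_fm j u (Beta a b i y) =
    Beta (subst_tm j u a) (subst_tm j u b) (subst_tm j u i) (subst_tm j u y)"
  by (simp add: Beta_def Let_def subst_Lt subst_lift_tm)

text \<open>Outer variables enter a graph formula only through \<open>ts\<close> and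
  \<open>t\<close>. The bound \<open>i + length gs \<le> j\<close> keeps the result slots, which
  belong to the quantifier block of \<open>RComp\<close>, below the substituted index.\<close>

lemma subst_Graph_aux:
  "has_arity f (length ts) \<Longrightarrow>
     subst_fm j u (Graph f ts t) = Graph f (map (subst_tm j u) ts) (subst_tm j u t)"
  "\<forall>g\<in>set gs. has_arity g (length ts) \<Longrightarrow> i + length gs \<le> j \<Longrightarrow>
     subst_fm j u (Graphs gs ts i) = Graphs gs (map (subst_tm j u) ts) i"
proof (induction f ts t and gs ts i arbitrary: j u and j u rule: Graph_Graphs.induct)
  case (2 ts t)
  then show ?case by (cases ts) auto
next
  case (4 f gs ts t)
  let ?k = "length gs"
  let ?s = "subst_tm (j + ?k) (lifts ?k u)"
  have vars: "map ?s (map Var [0..<?k]) = map Var [0..<?k]"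
    by auto
  have "has_arity f (length (map Var [0..<?k]))" using 4 by simp
  with 4 have "subst_fm (j + ?k) (lifts ?k u) (Graph f (map Var [0..<?k]) (lifts ?k t))
      = Graph f (map ?s (map Var [0..<?k])) (?s (lifts ?k t))"
    by blast
  then have "subst_fm (j + ?k) (lifts ?k u) (Graph f (map Var [0..<?k]) (lifts ?k t))
      = Graph f (map Var [0..<?k]) (lifts ?k (subst_tm j u t))"
    by (simp only: vars subst_lifts)
  then show ?case
    using 4 by (simp add: Let_def subst_Exists_funpow subst_lifts comp_def)
next
  case (5 f g ts t)
  then have "ts \<noteq> []" by auto
  then show ?case
    using 5 by (cases ts) (simp_all add: numeral_eq_Suc subst_Beta subst_Lt subst_lift_tm comp_def)
next
  case (6 f ts t)
  then show ?case
    by (simp add: numeral_eq_Suc subst_Lt subst_lift_tm comp_def)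
qed auto

lemma subst_Graph:
  "has_arity f (length ts) \<Longrightarrow>
     subst_fm j u (Graph f ts t) = Graph f (map (subst_tm j u) ts) (subst_tm j u t)"
  by (rule subst_Graph_aux)

lemma has_arity_r_pow2: "has_arity r_pow2 1"
  by (simp add: r_pow2_def r_add_def)

lemma subst_Len: "subst_fm j u (Len p k) = Len (subst_tm j u p) (subst_tm j u k)"
  using has_arity_r_pow2 by (simp add: Len_def subst_Graph subst_Le subst_Lt subst_lift_tm)

lemma subst_C_eq:
  "has_arity D 1 \<Longrightarrow> subst_fm j u (C_eq D x k) = C_eq D (subst_tm j u x) (subst_tm j u k)"
  by (simp add: C_eq_def subst_Graph subst_Len subst_Le subst_lift_tm numeral_eq_Suc)

lemma lift_numeral [simp]: "lift_tm k (numeral_tm n) = numeral_tm n"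
  by (induction n) auto

lemma subst_numeral [simp]: "subst_tm k u (numeral_tm n) = numeral_tm n"
  by (induction n) auto

text \<open>\<open>C_ge\<close> and \<open>C_gt\<close> with the string as \<open>Var 0\<close> and the bound as \<open>Var 1\<close>.\<close>

definition C_ge_open :: "recf \<Rightarrow> fm" where
  "C_ge_open D = Forall (Imp (C_eq D (Var 1) (Var 0)) (Le (Var 2) (Var 0)))"

definition C_gt_open :: "recf \<Rightarrow> fm" where
  "C_gt_open D = Forall (Imp (C_eq D (Var 1) (Var 0)) (Lt (Var 2) (Var 0)))"

text \<open>Makes the added axiom computable from \<open>x\<close> and \<open>m\<close>: one fixed
  formula and two numeral substitutions. Filling the string slot first lowers the bound to
  \<open>Var 0\<close>, so both use index 0.\<close>

lemma subst_C_ge_open: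
  "has_arity D 1 \<Longrightarrow>
     subst_fm 0 (numeral_tm m) (subst_fm 0 (numeral_tm (str_code x)) (C_ge_open D)) = C_ge D x m"
  by (simp add: C_ge_open_def C_ge_def subst_C_eq subst_Le)

lemma subst_C_gt_open:
  "has_arity D 1 \<Longrightarrow>
     subst_fm 0 (numeral_tm m) (subst_fm 0 (numeral_tm (str_code x)) (C_gt_open D)) = C_gt D x m"
  by (simp add: C_gt_open_def C_gt_def subst_C_eq subst_Lt)

subsection \<open>Codes of terms and formulas\<close>

abbreviation pair :: "nat \<Rightarrow> nat \<Rightarrow> nat" (infixr "\<bullet>" 60) where
  "a \<bullet> b \<equiv> prod_encode (a, b)"

text \<open>Terms and formulas share one tag system, so the same lifting and substitution clauses
  serve both. \<open>Sc\<close> gets a dummy leaf as second component: all tags from 3 on are then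
  binary nodes covered by a single clause.\<close>

primrec enc_tm :: "tm \<Rightarrow> nat" where
  "enc_tm (Var n) = 0 \<bullet> n"
| "enc_tm Zr = 1 \<bullet> 0"
| "enc_tm (Sc t) = 3 \<bullet> enc_tm t \<bullet> 1 \<bullet> 0"
| "enc_tm (Add s t) = 4 \<bullet> enc_tm s \<bullet> enc_tm t"
| "enc_tm (Mul s t) = 5 \<bullet> enc_tm s \<bullet> enc_tm t"

primrec enc_fm :: "fm \<Rightarrow> nat" where
  "enc_fm Fls = 1 \<bullet> 0"
| "enc_fm (Forall \<phi>) = 2 \<bullet> enc_fm \<phi>"
| "enc_fm (Eq s t) = 6 \<bullet> enc_tm s \<bullet> enc_tm t"
| "enc_fm (Imp \<phi> \<psi>) = 7 \<bullet> enc_fm \<phi> \<bullet> enc_fm \<psi>"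

text \<open>Termination of decoding: below a nonzero tag, the content is a smaller number.\<close>

lemma psnd_less:
  assumes "0 < pfst z" shows "psnd z < z"
proof -
  obtain a where "pfst z = Suc a" using assms by (cases "pfst z") auto
  then have "z = triangle (Suc (a + psnd z)) + Suc a"
    using prod_encode_pfst_psnd[of z] by (simp add: prod_encode_def)
  then show ?thesis by simp
qed

lemma pfst_le: "pfst z \<le> z" and psnd_le: "psnd z \<le> z"
  using le_prod_encode_1[of "pfst z" "psnd z"] le_prod_encode_2[of "psnd z" "pfst z"] by simp_all

text \<open>Every number decodes to a term and to a formula, which keeps the clauses below sound without
  side conditions on well-formedness.\<close>

function dec_tm :: "nat \<Rightarrow> tm" where
  "dec_tm z = (let a = pfst (psnd z); b = psnd (psnd z) in
     if pfst z = 0 then Var (psnd z)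
     else if pfst z = 3 then Sc (dec_tm a)
     else if pfst z = 4 then Add (dec_tm a) (dec_tm b)
     else if pfst z = 5 then Mul (dec_tm a) (dec_tm b)
     else Zr)"
  by pat_completeness auto
termination
  by (relation "Wellfounded.measure id")
    (auto intro: le_less_trans[OF pfst_le psnd_less] le_less_trans[OF psnd_le psnd_less])

function dec_fm :: "nat \<Rightarrow> fm" where
  "dec_fm z = (let a = pfst (psnd z); b = psnd (psnd z) in
     if pfst z = 2 then Forall (dec_fm (psnd z))
     else if pfst z = 6 then Eq (dec_tm a) (dec_tm b)
     else if pfst z = 7 then Imp (dec_fm a) (dec_fm b)
     else Fls)"
  by pat_completeness auto
termination
  by (relation "Wellfounded.measure id")
    (auto intro: psnd_less le_less_trans[OF pfst_le psnd_less] le_less_trans[OF psnd_le psnd_less])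

declare dec_tm.simps [simp del] dec_fm.simps [simp del]

lemma dec_tm_pair [simp]:
  "dec_tm (k \<bullet> c) = (
     if k = 0 then Var c
     else if k = 3 then Sc (dec_tm (pfst c))
     else if k = 4 then Add (dec_tm (pfst c)) (dec_tm (psnd c))
     else if k = 5 then Mul (dec_tm (pfst c)) (dec_tm (psnd c))
     else Zr)"
  by (subst dec_tm.simps) (simp add: Let_def)

lemma dec_fm_pair [simp]:
  "dec_fm (k \<bullet> c) = (
     if k = 2 then Forall (dec_fm c)
     else if k = 6 then Eq (dec_tm (pfst c)) (dec_tm (psnd c))
     else if k = 7 then Imp (dec_fm (pfst c)) (dec_fm (psnd c))
     else Fls)"
  by (subst dec_fm.simps) (simp add: Let_def)

lemma dec_enc_tm [simp]: "dec_tm (enc_tm t) = t"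
  by (induction t) auto

lemma dec_enc_fm [simp]: "dec_fm (enc_fm \<phi>) = \<phi>"
  by (induction \<phi>) auto

subsection \<open>Codes of binary strings\<close>

lemma str_code_append: "str_code (q @ [b]) = 2 * str_code q + (if b then 2 else 1)"
  by (simp add: str_code_def)

lemma str_code_Nil [simp]: "str_code [] = 0"
  by (simp add: str_code_def)

lemma surj_str_code: "\<exists>x. str_code x = y"
proof (induction y rule: less_induct)
  case (less y)
  show ?case
  proof (cases "y = 0")
    case True
    then show ?thesis using str_code_Nil by blast
  next
    case False
    then obtain q where "str_code q = (y - 1) div 2" using less[of "(y - 1) div 2"] by fastforce
    \<comment> \<open>In this notation with digits 1 and 2, odd numbers end in 1
      (\<open>False\<close>) and positive even ones in 2 (\<open>True\<close>).\<close>
    with False have "str_code (q @ [even y]) = y"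
      unfolding str_code_append by (cases "even y") (auto elim!: evenE oddE)
    then show ?thesis by blast
  qed
qed

lemma str_code_length: "2 ^ length p \<le> str_code p + 1 \<and> str_code p + 1 < 2 * 2 ^ length p"
  by (induction p rule: rev_induct) (auto simp: str_code_append)

lemma inj_str_code: "str_code p = str_code q \<Longrightarrow> p = q"
proof (induction p arbitrary: q rule: rev_induct)
  case Nil
  then show ?case by (cases q rule: rev_cases) (auto simp: str_code_append split: if_splits)
next
  case (snoc b p)
  show ?case
  proof (cases q rule: rev_cases)
    case Nil
    with snoc.prems show ?thesis by (simp add: str_code_append split: if_splits)
  next
    case (snoc q' b')
    have "str_code p = str_code q' \<and> b = b'"
      using snoc.prems unfolding snoc str_code_append by (cases b; cases b'; simp; presburger)
    with snoc.IH snoc show ?thesis by blast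
  qed
qed

subsection \<open>Proof search as a set of Horn clauses\<close>

notation (input) PP (infixr "\<star>" 60)

text \<open>The first component of a fact names its predicate; these tags are independent of the
  tags of syntax codes.\<close>

abbreviation (input) "LessP p q \<equiv> PC 0 \<star> p \<star> q"
abbreviation (input) "LiftP k p q \<equiv> PC 1 \<star> k \<star> p \<star> q"
abbreviation (input) "SubstP k u p q \<equiv> PC 2 \<star> k \<star> u \<star> p \<star> q"
abbreviation (input) "NumeralP n p \<equiv> PC 3 \<star> n \<star> p"
abbreviation (input) "StringP s n \<equiv> PC 4 \<star> s \<star> n"
abbreviation (input) "InputP p s n c \<equiv> PC 5 \<star> p \<star> s \<star> n \<star> c"
abbreviation (input) "ProvP h p \<equiv> PC 6 \<star> h \<star> p"
abbreviation (input) "OutputP p y \<equiv> PC 7 \<star> p \<star> y"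

abbreviation (input) "VarP n \<equiv> PC 0 \<star> n"
abbreviation (input) "LeafP \<equiv> PC 1 \<star> PC 0"
abbreviation (input) "AllP p \<equiv> PC 2 \<star> p"
abbreviation (input) "BinP k p q \<equiv> PAdd (PC 3) k \<star> p \<star> q"
abbreviation (input) "ScP p \<equiv> PC 3 \<star> p \<star> LeafP"
abbreviation (input) "EqP p q \<equiv> PC 6 \<star> p \<star> q"
abbreviation (input) "ImpP p q \<equiv> PC 7 \<star> p \<star> q"

definition less_clauses :: "clause list" where
  "less_clauses =
    [([], LessP (PC 0) (PS (PV 0))),
     ([LessP (PV 0) (PV 1)], LessP (PS (PV 0)) (PS (PV 1)))]"

text \<open>The tag of a binary node is a free variable of its clause. Tags beyond 7 do no harm:
  such nodes decode to \<open>Zr\<close> and \<open>Fls\<close>, which lifting fixes.\<close>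

definition lift_clauses :: "clause list" where
  "lift_clauses =
    [([LessP (PV 1) (PV 0)], LiftP (PV 0) (VarP (PV 1)) (VarP (PV 1))),
     ([LessP (PV 0) (PS (PV 1))], LiftP (PV 0) (VarP (PV 1)) (VarP (PS (PV 1)))),
     ([], LiftP (PV 0) LeafP LeafP),
     ([LiftP (PV 0) (PV 1) (PV 2), LiftP (PV 0) (PV 3) (PV 4)],
        LiftP (PV 0) (BinP (PV 5) (PV 1) (PV 3)) (BinP (PV 5) (PV 2) (PV 4))),
     ([LiftP (PS (PV 0)) (PV 1) (PV 2)], LiftP (PV 0) (AllP (PV 1)) (AllP (PV 2)))]"

text \<open>The second and the third clause replace a variable by a code \<open>u\<close> whose tag is that of a term. Without this
  restriction \<open>u\<close> might decode to a formula, while a variable decodes to \<open>Fls\<close>.\<close>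

definition subst_clauses :: "clause list" where
  "subst_clauses =
    [([LessP (PV 1) (PV 0)], SubstP (PV 0) (PV 2) (VarP (PV 1)) (VarP (PV 1))),
     ([LessP (PV 1) (PC 2)], SubstP (PV 0) (PV 1 \<star> PV 2) (VarP (PV 0)) (PV 1 \<star> PV 2)),
     ([LessP (PV 1) (PC 3)], SubstP (PV 0) (PAdd (PC 3) (PV 1) \<star> PV 2) (VarP (PV 0)) (PAdd (PC 3) (PV 1) \<star> PV 2)),
     ([LessP (PV 0) (PS (PV 1))], SubstP (PV 0) (PV 2) (VarP (PS (PV 1))) (VarP (PV 1))),
     ([], SubstP (PV 0) (PV 2) LeafP LeafP),
     ([SubstP (PV 0) (PV 1) (PV 2) (PV 3), SubstP (PV 0) (PV 1) (PV 4) (PV 5)],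
        SubstP (PV 0) (PV 1) (BinP (PV 6) (PV 2) (PV 4)) (BinP (PV 6) (PV 3) (PV 5))),
     ([LiftP (PC 0) (PV 1) (PV 2), SubstP (PS (PV 0)) (PV 2) (PV 3) (PV 4)],
        SubstP (PV 0) (PV 1) (AllP (PV 3)) (AllP (PV 4)))]"

text \<open>Appending \<open>False\<close> or \<open>True\<close> takes a code s to 2s + 1 or 2s +
  2. The \<open>InputP\<close> clauses thus parse a program from its end: a counted run of
  \<open>True\<close>, one \<open>False\<close>, and the rest is the string.\<close>

definition input_clauses :: "clause list" where
  "input_clauses =
    [([], NumeralP (PC 0) LeafP),
     ([NumeralP (PV 0) (PV 1)], NumeralP (PS (PV 0)) (ScP (PV 1))),
     ([], StringP (PC 0) (PC 0)),
     ([StringP (PV 0) (PV 1)], StringP (PS (PAdd (PV 0) (PV 0))) (PS (PV 1))),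
     ([StringP (PV 0) (PV 1)], StringP (PS (PS (PAdd (PV 0) (PV 0)))) (PS (PV 1))),
     ([StringP (PV 0) (PV 1)], InputP (PS (PAdd (PV 0) (PV 0))) (PV 0) (PV 1) (PC 0)),
     ([InputP (PV 0) (PV 1) (PV 2) (PV 3)],
        InputP (PS (PS (PAdd (PV 0) (PV 0)))) (PV 1) (PV 2) (PS (PV 3)))]"

text \<open>One clause for each rule of \<open>provable\<close> except \<open>Ax\<close>;
  \<open>PV 0\<close> carries the code of the added axiom unchanged.\<close>

definition logic_clauses :: "clause list" where
  "logic_clauses =
    [([], ProvP (PV 0) (ImpP (PV 1) (ImpP (PV 2) (PV 1)))),
     ([], ProvP (PV 0) (ImpP (ImpP (PV 1) (ImpP (PV 2) (PV 3)))
            (ImpP (ImpP (PV 1) (PV 2)) (ImpP (PV 1) (PV 3))))),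
     ([], ProvP (PV 0) (ImpP (ImpP (ImpP (PV 1) LeafP) LeafP) (PV 1))),
     ([SubstP (PC 0) (PV 1) (PV 2) (PV 3)], ProvP (PV 0) (ImpP (AllP (PV 2)) (PV 3))),
     ([], ProvP (PV 0) (ImpP (AllP (ImpP (PV 1) (PV 2))) (ImpP (AllP (PV 1)) (AllP (PV 2))))),
     ([LiftP (PC 0) (PV 1) (PV 2)], ProvP (PV 0) (ImpP (PV 1) (AllP (PV 2)))),
     ([], ProvP (PV 0) (EqP (PV 1) (PV 1))),
     ([SubstP (PC 0) (PV 1) (PV 3) (PV 4), SubstP (PC 0) (PV 2) (PV 3) (PV 5)],
        ProvP (PV 0) (ImpP (EqP (PV 1) (PV 2)) (ImpP (PV 4) (PV 5)))),
     ([ProvP (PV 0) (ImpP (PV 1) (PV 2)), ProvP (PV 0) (PV 1)], ProvP (PV 0) (PV 2)),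
     ([ProvP (PV 0) (PV 1)], ProvP (PV 0) (AllP (PV 1)))]"

definition PA_axioms :: "fm list" where
  "PA_axioms =
     [Forall (Neg (Eq (Sc (Var 0)) Zr)),
      Forall (Forall (Imp (Eq (Sc (Var 1)) (Sc (Var 0))) (Eq (Var 1) (Var 0)))),
      Forall (Eq (Add (Var 0) Zr) (Var 0)),
      Forall (Forall (Eq (Add (Var 1) (Sc (Var 0))) (Sc (Add (Var 1) (Var 0))))),
      Forall (Eq (Mul (Var 0) Zr) Zr),
      Forall (Forall (Eq (Mul (Var 1) (Sc (Var 0))) (Add (Mul (Var 1) (Var 0)) (Var 1))))]"

lemma PA_eq: "PA = set PA_axioms \<union> range induction_axiom"
  by (simp add: PA_def PA_axioms_def)

text \<open>The infinite induction scheme is one clause: its premises compute the instances at zero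
  and at the successor from the formula coded by \<open>PV 1\<close>.\<close>

definition axiom_clauses :: "clause list" where
  "axiom_clauses =
     ([], ProvP (PV 0) (PV 0)) #
     ([SubstP (PC 0) LeafP (PV 1) (PV 2), LiftP (PC 1) (PV 1) (PV 3),
       SubstP (PC 0) (ScP (VarP (PC 0))) (PV 3) (PV 4)],
        ProvP (PV 0) (ImpP (PV 2) (ImpP (AllP (ImpP (PV 1) (PV 4))) (AllP (PV 1))))) #
     map (\<lambda>\<phi>. ([], ProvP (PV 0) (PC (enc_fm \<phi>)))) PA_axioms"

text \<open>The program \<open>r01\<^sup>c\<close>, where \<open>r\<close> has length \<open>n\<close>, searches for a proof of \<open>C(x) > n + (2c + 1)\<close>
  from \<open>C(r) \<ge> n\<close>.\<close>

definition output_clauses :: "recf \<Rightarrow> clause list" where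
  "output_clauses D =
    [([InputP (PV 0) (PV 1) (PV 2) (PV 3), NumeralP (PV 1) (PV 4), NumeralP (PV 2) (PV 5),
       SubstP (PC 0) (PV 4) (PC (enc_fm (C_ge_open D))) (PV 6), SubstP (PC 0) (PV 5) (PV 6) (PV 7),
       NumeralP (PV 8) (PV 9), NumeralP (PAdd (PV 2) (PAdd (PV 3) (PS (PV 3)))) (PV 10),
       SubstP (PC 0) (PV 9) (PC (enc_fm (C_gt_open D))) (PV 11), SubstP (PC 0) (PV 10) (PV 11) (PV 12),
       ProvP (PV 7) (PV 12)],
      OutputP (PV 0) (PV 8))]"

definition search_clauses :: "recf \<Rightarrow> clause list" where
  "search_clauses D = less_clauses @ lift_clauses @ subst_clauses @ input_clauses @ logic_clauses
     @ axiom_clauses @ output_clauses D"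

abbreviation derives :: "recf \<Rightarrow> nat \<Rightarrow> bool" where
  "derives D \<equiv> horn (set (search_clauses D))"

definition program :: "bool list \<Rightarrow> nat \<Rightarrow> nat" where
  "program r c = str_code (r @ False # replicate c True)"

lemma program_0: "program r 0 = Suc (str_code r + str_code r)"
  using str_code_append[of r False] by (simp add: program_def)

lemma program_Suc: "program r (Suc c) = Suc (Suc (program r c + program r c))"
  using str_code_append[of "r @ False # replicate c True" True]
  by (simp add: program_def replicate_append_same)

text \<open>The intended meaning of each fact, invariant under the clauses. Lifting and substitution
  are asserted for both readings of a code, as term and as formula, since their clauses do not
  distinguish them.\<close>

definition holds :: "recf \<Rightarrow> nat \<Rightarrow> bool" where
  "holds D z = (let k = pfst z; a = pfst (psnd z); y = psnd (psnd z);
       b = pfst y; y' = psnd y; c = pfst y'; d = psnd y' in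
     if k = 0 then a < y
     else if k = 1 then dec_tm y' = lift_tm a (dec_tm b) \<and> dec_fm y' = lift_fm a (dec_fm b)
     else if k = 2 then dec_tm d = subst_tm a (dec_tm b) (dec_tm c)
       \<and> dec_fm d = subst_fm a (dec_tm b) (dec_fm c)
     else if k = 3 then dec_tm y = numeral_tm a
     else if k = 4 then \<exists>r. a = str_code r \<and> y = length r
     else if k = 5 then \<exists>r. a = program r d \<and> b = str_code r \<and> c = length r
     else if k = 6 then PA \<union> {dec_fm a} \<turnstile> dec_fm y
     else \<exists>r c x. a = program r c \<and> y = str_code x
       \<and> PA \<union> {C_ge D r (length r)} \<turnstile> C_gt D x (length r + (c + Suc c)))"

section \<open>Soundness of the clauses\<close>

definition sound :: "recf \<Rightarrow> clause list \<Rightarrow> bool" where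
  "sound D rs \<longleftrightarrow> (\<forall>(ps, c)\<in>set rs. \<forall>\<sigma>. (\<forall>p\<in>set ps. holds D (peval \<sigma> p)) \<longrightarrow> holds D (peval \<sigma> c))"

lemma sound_less: "sound D less_clauses"
  by (simp add: sound_def less_clauses_def holds_def Let_def)

lemma sound_lift: "sound D lift_clauses"
  by (simp add: sound_def lift_clauses_def holds_def Let_def)

lemma sound_subst: "sound D subst_clauses"
  by (simp add: sound_def subst_clauses_def holds_def Let_def)

lemma sound_input: "sound D input_clauses"
proof -
  have "\<exists>s. Suc (str_code r + str_code r) = str_code s \<and> Suc (length r) = length s" for r
    by (rule exI[of _ "r @ [False]"]) (simp add: str_code_append)
  moreover have "\<exists>s. Suc (Suc (str_code r + str_code r)) = str_code s \<and> Suc (length r) = length s" for r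
    by (rule exI[of _ "r @ [True]"]) (simp add: str_code_append)
  moreover have "\<exists>s. Suc (str_code r + str_code r) = program s 0 \<and> str_code r = str_code s
      \<and> length r = length s" for r
    using program_0 by metis
  moreover have "\<exists>s. Suc (Suc (program r c + program r c)) = program s (Suc c)
      \<and> str_code r = str_code s \<and> length r = length s" for r c
    using program_Suc by metis
  ultimately show ?thesis
    by (auto simp: sound_def input_clauses_def holds_def Let_def)
qed

lemma sound_logic: "sound D logic_clauses"
  by (auto simp: sound_def logic_clauses_def holds_def Let_def intro: provable.intros)

lemma sound_axiom: "sound D axiom_clauses"
proof -
  have "induction_axiom \<phi> \<in> PA \<union> {h}" for \<phi> h by (simp add: PA_def)
  then have "PA \<union> {h} \<turnstile> induction_axiom \<phi>" for \<phi> h by (rule provable.Ax)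
  moreover have "PA \<union> {h} \<turnstile> \<phi>" if "\<phi> \<in> set PA_axioms" for \<phi> h
    using that by (intro provable.Ax) (simp add: PA_eq)
  moreover have "PA \<union> {h} \<turnstile> h" for h by (rule provable.Ax) simp
  ultimately show ?thesis
    by (simp add: sound_def axiom_clauses_def holds_def Let_def induction_axiom_def)
qed

lemma sound_output:
  assumes "has_arity D 1" shows "sound D (output_clauses D)"
proof -
  \<comment> \<open>Every number codes a string, so the candidate answer \<open>PV 8\<close> needs
    no check.\<close>
  obtain str where str: "\<And>y. str_code (str y) = y" using surj_str_code by metis
  have gt: "subst_fm 0 (numeral_tm m) (subst_fm 0 (numeral_tm y) (C_gt_open D)) = C_gt D (str y) m"
    for m y
    using subst_C_gt_open[OF assms, of m "str y"] by (simp add: str)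
  have ge: "subst_fm 0 (numeral_tm m) (subst_fm 0 (numeral_tm (str_code x)) (C_ge_open D)) = C_ge D x m"
    for m x
    using assms by (rule subst_C_ge_open)
  show ?thesis
    unfolding sound_def output_clauses_def
    by (auto simp: holds_def Let_def ge gt simp del: numeral_tm.simps) (metis str)
qed

lemma sound_append: "sound D (rs @ ss) \<longleftrightarrow> sound D rs \<and> sound D ss"
  by (simp add: sound_def ball_Un)

lemma search_sound:
  assumes "has_arity D 1" "derives D x" shows "holds D x"
  using assms(2)
proof (induction rule: horn.induct)
  case (1 ps c \<sigma>)
  have "sound D (search_clauses D)"
    using assms(1) by (simp add: search_clauses_def sound_append sound_less sound_lift sound_subst
        sound_input sound_logic sound_axiom sound_output)
  then show ?case
    using 1 unfolding sound_def by blast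
qed

text \<open>Format of the completeness proofs: \<open>i\<close> selects the clause and
  \<open>vs\<close> lists the values of its variables in order.\<close>

lemma clause_step:
  assumes "set rs \<subseteq> set (search_clauses D)" "i < length rs"
    and "\<forall>p\<in>set (fst (rs ! i)). derives D (peval (nth vs) p)"
  shows "derives D (peval (nth vs) (snd (rs ! i)))"
proof (rule horn.intros)
  show "(fst (rs ! i), snd (rs ! i)) \<in> set (search_clauses D)"
    using assms(1,2) by auto
qed (use assms(3) in blast)

lemma clauses_subset:
  "set less_clauses \<subseteq> set (search_clauses D)"
  "set lift_clauses \<subseteq> set (search_clauses D)"
  "set subst_clauses \<subseteq> set (search_clauses D)"
  "set input_clauses \<subseteq> set (search_clauses D)"
  "set logic_clauses \<subseteq> set (search_clauses D)"
  "set axiom_clauses \<subseteq> set (search_clauses D)"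
  "set (output_clauses D) \<subseteq> set (search_clauses D)"
  by (auto simp: search_clauses_def)

lemmas less_step = clause_step[OF clauses_subset(1)]
lemmas lift_step = clause_step[OF clauses_subset(2)]
lemmas subst_step = clause_step[OF clauses_subset(3)]
lemmas input_step = clause_step[OF clauses_subset(4)]
lemmas logic_step = clause_step[OF clauses_subset(5)]
lemmas axiom_step = clause_step[OF clauses_subset(6)]
lemmas output_step = clause_step[OF clauses_subset(7)]

section \<open>Completeness of the clauses\<close>

lemma derives_less: "a < b \<Longrightarrow> derives D (0 \<bullet> a \<bullet> b)"
proof (induction a arbitrary: b)
  case 0
  then obtain c where "b = Suc c" by (cases b) auto
  then show ?case
    using less_step[of 0 D "[c]"] by (simp add: less_clauses_def)
next
  case (Suc a)
  then obtain c where "b = Suc c" "a < c" by (cases b) auto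
  then show ?case
    using less_step[of 1 D "[a, c]"] Suc.IH by (simp add: less_clauses_def)
qed

lemma derives_lift_bin:
  assumes "derives D (1 \<bullet> k \<bullet> a \<bullet> a')" "derives D (1 \<bullet> k \<bullet> b \<bullet> b')"
  shows "derives D (1 \<bullet> k \<bullet> (3 + g \<bullet> a \<bullet> b) \<bullet> (3 + g \<bullet> a' \<bullet> b'))"
  using lift_step[of 3 D "[k, a, a', b, b', g]"] assms by (simp add: lift_clauses_def)

lemma derives_lift_leaf: "derives D (1 \<bullet> k \<bullet> (1 \<bullet> 0) \<bullet> 1 \<bullet> 0)"
  using lift_step[of 2 D "[k]"] by (simp add: lift_clauses_def)

lemma derives_lift_tm: "derives D (1 \<bullet> k \<bullet> enc_tm t \<bullet> enc_tm (lift_tm k t))"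
proof (induction t)
  case (Var n)
  show ?case
  proof (cases "n < k")
    case True
    then show ?thesis
      using lift_step[of 0 D "[k, n]"] derives_less[of n k D] by (simp add: lift_clauses_def)
  next
    case False
    then show ?thesis
      using lift_step[of 1 D "[k, n]"] derives_less[of k "Suc n" D] by (simp add: lift_clauses_def)
  qed
next
  case Zr
  then show ?case using derives_lift_leaf by simp
next
  case (Sc t)
  then show ?case using derives_lift_bin[where g = 0, OF Sc derives_lift_leaf] by simp
next
  case (Add s t)
  then show ?case using derives_lift_bin[where g = 1, OF Add] by simp
next
  case (Mul s t)
  then show ?case using derives_lift_bin[where g = 2, OF Mul] by simp
qed

lemma derives_lift_fm: "derives D (1 \<bullet> k \<bullet> enc_fm \<phi> \<bullet> enc_fm (lift_fm k \<phi>))"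
proof (induction \<phi> arbitrary: k)
  case Fls
  then show ?case using derives_lift_leaf by simp
next
  case (Eq s t)
  then show ?case using derives_lift_bin[where g = 3, OF derives_lift_tm derives_lift_tm] by simp
next
  case (Imp \<phi> \<psi>)
  then show ?case using derives_lift_bin[where g = 4, OF Imp] by simp
next
  case (Forall \<phi>)
  then show ?case
    using lift_step[of 4 D "[k, enc_fm \<phi>, enc_fm (lift_fm (Suc k) \<phi>)]"] by (simp add: lift_clauses_def)
qed

lemma derives_subst_bin:
  assumes "derives D (2 \<bullet> k \<bullet> u \<bullet> a \<bullet> a')" "derives D (2 \<bullet> k \<bullet> u \<bullet> b \<bullet> b')"
  shows "derives D (2 \<bullet> k \<bullet> u \<bullet> (3 + g \<bullet> a \<bullet> b) \<bullet> (3 + g \<bullet> a' \<bullet> b'))"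
  using subst_step[of 5 D "[k, u, a, a', b, b', g]"] assms by (simp add: subst_clauses_def)

lemma derives_subst_leaf: "derives D (2 \<bullet> k \<bullet> u \<bullet> (1 \<bullet> 0) \<bullet> 1 \<bullet> 0)"
  \<comment> \<open>The 0 is a filler: \<open>PV 1\<close> does not occur in this clause.\<close>
  using subst_step[of 4 D "[k, 0, u]"] by (simp add: subst_clauses_def)

text \<open>Term codes carry the tags 0, 1 and 3 to 5, just those that the two guarded clauses
  admit.\<close>

lemma derives_subst_var: "derives D (2 \<bullet> k \<bullet> enc_tm u \<bullet> (0 \<bullet> k) \<bullet> enc_tm u)"
proof -
  have small: "derives D (2 \<bullet> k \<bullet> (g \<bullet> b) \<bullet> (0 \<bullet> k) \<bullet> (g \<bullet> b))" if "g < 2" for g b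
    using subst_step[of 1 D "[k, g, b]"] derives_less[OF that] by (simp add: subst_clauses_def)
  have large: "derives D (2 \<bullet> k \<bullet> (3 + g \<bullet> b) \<bullet> (0 \<bullet> k) \<bullet> (3 + g \<bullet> b))" if "g < 3" for g b
    using subst_step[of 2 D "[k, g, b]"] derives_less[OF that] by (simp add: subst_clauses_def)
  show ?thesis
    using small[of 0] small[of 1] large[of 0] large[of 1] large[of 2] by (cases u) simp_all
qed

lemma derives_subst_tm: "derives D (2 \<bullet> k \<bullet> enc_tm u \<bullet> enc_tm t \<bullet> enc_tm (subst_tm k u t))"
proof (induction t)
  case (Var n)
  consider "n < k" | "n = k" | m where "n = Suc m" "k < Suc m" by (cases n) fastforce+
  then show ?case
  proof cases
    case 1
    then show ?thesis
      using subst_step[of 0 D "[k, n, enc_tm u]"] derives_less[of n k D] by (simp add: subst_clauses_def)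
  next
    case 2
    then show ?thesis using derives_subst_var by simp
  next
    case 3
    then show ?thesis
      using subst_step[of 3 D "[k, m, enc_tm u]"] derives_less[of k "Suc m" D]
      by (simp add: subst_clauses_def)
  qed
next
  case Zr
  then show ?case using derives_subst_leaf by simp
next
  case (Sc t)
  then show ?case using derives_subst_bin[where g = 0, OF Sc derives_subst_leaf] by simp
next
  case (Add s t)
  then show ?case using derives_subst_bin[where g = 1, OF Add] by simp
next
  case (Mul s t)
  then show ?case using derives_subst_bin[where g = 2, OF Mul] by simp
qed

lemma derives_subst_fm: "derives D (2 \<bullet> k \<bullet> enc_tm u \<bullet> enc_fm \<phi> \<bullet> enc_fm (subst_fm k u \<phi>))"
proof (induction \<phi> arbitrary: k u)
  case Fls
  then show ?case using derives_subst_leaf by simp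
next
  case (Eq s t)
  then show ?case using derives_subst_bin[where g = 3, OF derives_subst_tm derives_subst_tm] by simp
next
  case (Imp \<phi> \<psi>)
  then show ?case using derives_subst_bin[where g = 4, OF Imp] by simp
next
  case (Forall \<phi>)
  then show ?case
    using derives_lift_tm[of D 0 u]
      subst_step[of 6 D "[k, enc_tm u, enc_tm (lift_tm 0 u), enc_fm \<phi>, enc_fm (subst_fm (Suc k) (lift_tm 0 u) \<phi>)]"]
    by (simp add: subst_clauses_def)
qed

lemma derives_numeral: "derives D (3 \<bullet> n \<bullet> enc_tm (numeral_tm n))"
proof (induction n)
  case 0
  show ?case using input_step[of 0 D] by (simp add: input_clauses_def)
next
  case (Suc n)
  then show ?case
    using input_step[of 1 D "[n, enc_tm (numeral_tm n)]"] by (simp add: input_clauses_def)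
qed

lemma derives_string: "derives D (4 \<bullet> str_code r \<bullet> length r)"
proof (induction r rule: rev_induct)
  case Nil
  show ?case using input_step[of 2 D] by (simp add: input_clauses_def)
next
  case (snoc b r)
  then show ?case
    using input_step[of 3 D "[str_code r, length r]"] input_step[of 4 D "[str_code r, length r]"]
    by (cases b) (simp_all add: input_clauses_def str_code_append mult_2)
qed

lemma derives_input: "derives D (5 \<bullet> program r c \<bullet> str_code r \<bullet> length r \<bullet> c)"
proof (induction c)
  case 0
  show ?case
    using input_step[of 5 D "[str_code r, length r]"] derives_string[of D r]
    by (simp add: input_clauses_def program_0)
next
  case (Suc c)
  then show ?case
    using input_step[of 6 D "[program r c, str_code r, length r, c]"]
    by (simp add: input_clauses_def program_Suc)
qed

lemma derives_axiom:
  assumes "\<phi> \<in> PA \<union> {h}" shows "derives D (6 \<bullet> enc_fm h \<bullet> enc_fm \<phi>)"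
proof -
  consider "\<phi> = h" | i where "i < length PA_axioms" "\<phi> = PA_axioms ! i" | \<psi> where "\<phi> = induction_axiom \<psi>"
    using assms unfolding PA_eq by (auto simp: in_set_conv_nth)
  then show ?thesis
  proof cases
    case 1
    then show ?thesis using axiom_step[of 0 D "[enc_fm h]"] by (simp add: axiom_clauses_def)
  next
    case 2
    then show ?thesis
      \<comment> \<open>The clauses for the added axiom and for induction come before the
        list.\<close>
      using axiom_step[of "Suc (Suc i)" D "[enc_fm h]"] by (simp add: axiom_clauses_def)
  next
    case 3
    let ?b = "lift_fm 1 \<psi>"
    show ?thesis
      using axiom_step[of 1 D "[enc_fm h, enc_fm \<psi>, enc_fm (subst_fm 0 Zr \<psi>), enc_fm ?b,
            enc_fm (subst_fm 0 (Sc (Var 0)) ?b)]"]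
        derives_subst_fm[of D 0 Zr \<psi>] derives_lift_fm[of D 1 \<psi>]
        derives_subst_fm[of D 0 "Sc (Var 0)" ?b] 3
      by (simp add: axiom_clauses_def induction_axiom_def)
  qed
qed

lemma derives_provable:
  assumes "PA \<union> {h} \<turnstile> \<phi>" shows "derives D (6 \<bullet> enc_fm h \<bullet> enc_fm \<phi>)"
  using assms
proof (induction rule: provable.induct)
  case (Ax \<phi>)
  then show ?case by (rule derives_axiom)
next
  case (K \<phi> \<psi>)
  show ?case
    using logic_step[of 0 D "[enc_fm h, enc_fm \<phi>, enc_fm \<psi>]"] by (simp add: logic_clauses_def)
next
  case (S \<phi> \<psi> \<chi>)
  show ?case
    using logic_step[of 1 D "[enc_fm h, enc_fm \<phi>, enc_fm \<psi>, enc_fm \<chi>]"]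
    by (simp add: logic_clauses_def)
next
  case (DN \<phi>)
  show ?case
    using logic_step[of 2 D "[enc_fm h, enc_fm \<phi>]"] by (simp add: logic_clauses_def)
next
  case (Inst \<phi> t)
  show ?case
    using logic_step[of 3 D "[enc_fm h, enc_tm t, enc_fm \<phi>, enc_fm (subst_fm 0 t \<phi>)]"]
      derives_subst_fm[of D 0 t \<phi>]
    by (simp add: logic_clauses_def)
next
  case (Dist \<phi> \<psi>)
  show ?case
    using logic_step[of 4 D "[enc_fm h, enc_fm \<phi>, enc_fm \<psi>]"] by (simp add: logic_clauses_def)
next
  case (Vac \<phi>)
  show ?case
    using logic_step[of 5 D "[enc_fm h, enc_fm \<phi>, enc_fm (lift_fm 0 \<phi>)]"] derives_lift_fm[of D 0 \<phi>]
    by (simp add: logic_clauses_def)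
next
  case (Refl t)
  show ?case
    using logic_step[of 6 D "[enc_fm h, enc_tm t]"] by (simp add: logic_clauses_def)
next
  case (Leibniz s t \<phi>)
  show ?case
    using logic_step[of 7 D "[enc_fm h, enc_tm s, enc_tm t, enc_fm \<phi>, enc_fm (subst_fm 0 s \<phi>),
          enc_fm (subst_fm 0 t \<phi>)]"] derives_subst_fm[of D 0 s \<phi>] derives_subst_fm[of D 0 t \<phi>]
    by (simp add: logic_clauses_def)
next
  case (MP \<phi> \<psi>)
  then show ?case
    using logic_step[of 8 D "[enc_fm h, enc_fm \<phi>, enc_fm \<psi>]"] by (simp add: logic_clauses_def)
next
  case (Gen \<phi>)
  then show ?case
    using logic_step[of 9 D "[enc_fm h, enc_fm \<phi>]"] by (simp add: logic_clauses_def)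
qed

lemma derives_output:
  assumes D: "has_arity D 1"
    and proof_found: "PA \<union> {C_ge D r (length r)} \<turnstile> C_gt D x (length r + (c + Suc c))"
  shows "derives D (7 \<bullet> program r c \<bullet> str_code x)"
proof -
  let ?n = "length r" and ?m = "length r + (c + Suc c)"
  let ?ge = "subst_fm 0 (numeral_tm (str_code r)) (C_ge_open D)"
  let ?gt = "subst_fm 0 (numeral_tm (str_code x)) (C_gt_open D)"
  have "derives D (2 \<bullet> 0 \<bullet> enc_tm (numeral_tm ?n) \<bullet> enc_fm ?ge \<bullet> enc_fm (C_ge D r ?n))"
    using derives_subst_fm[of D 0 "numeral_tm ?n" ?ge] by (simp only: subst_C_ge_open[OF D])
  moreover have "derives D (2 \<bullet> 0 \<bullet> enc_tm (numeral_tm ?m) \<bullet> enc_fm ?gt \<bullet> enc_fm (C_gt D x ?m))"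
    using derives_subst_fm[of D 0 "numeral_tm ?m" ?gt] by (simp only: subst_C_gt_open[OF D])
  ultimately show ?thesis
    using output_step[of 0 D "[program r c, str_code r, ?n, c, enc_tm (numeral_tm (str_code r)),
          enc_tm (numeral_tm ?n), enc_fm ?ge, enc_fm (C_ge D r ?n), str_code x,
          enc_tm (numeral_tm (str_code x)), enc_tm (numeral_tm ?m), enc_fm ?gt, enc_fm (C_gt D x ?m)]"]
      derives_input[of D r c] derives_numeral[of D "str_code r"] derives_numeral[of D ?n]
      derives_subst_fm[of D 0 "numeral_tm (str_code r)" "C_ge_open D"]
      derives_numeral[of D "str_code x"] derives_numeral[of D ?m]
      derives_subst_fm[of D 0 "numeral_tm (str_code x)" "C_gt_open D"]
      derives_provable[OF proof_found, of D]
    by (simp add: output_clauses_def del: numeral_tm.simps)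
qed

subsection \<open>Kolmogorov complexity in the standard model\<close>

lemma ev_r_add: "ev r_add [a, b] = Some (a + b)"
  by (induction a) (simp_all add: r_add_def)

lemma ev_r_pow2: "ev r_pow2 [k] = Some (2 ^ k)"
  by (induction k) (simp_all add: r_pow2_def ev_r_add mult_2)

lemma sat_Len: "sat e (Len p k) \<longleftrightarrow> 2 ^ val e k \<le> val e p + 1 \<and> val e p + 1 < 2 * 2 ^ val e k"
  using has_arity_r_pow2 by (auto simp: Len_def ev_r_pow2)

lemma sat_Len_str_code:
  assumes "val e p = str_code q" shows "sat e (Len p k) \<longleftrightarrow> val e k = length q"
proof
  assume "sat e (Len p k)"
  then have k: "2 ^ val e k \<le> str_code q + 1" "str_code q + 1 < 2 ^ Suc (val e k)"
    using assms by (simp_all add: sat_Len)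
  have q: "2 ^ length q \<le> str_code q + 1" "str_code q + 1 < 2 ^ Suc (length q)"
    using str_code_length[of q] by simp_all
  have "(2::nat) ^ val e k < 2 ^ Suc (length q)" "(2::nat) ^ length q < 2 ^ Suc (val e k)"
    using k q by linarith+
  then have "val e k < Suc (length q)" "length q < Suc (val e k)"
    by (meson one_less_numeral_iff power_less_imp_less_exp semiring_norm(76))+
  then show "val e k = length q" by simp
qed (use assms str_code_length[of q] in \<open>simp add: sat_Len\<close>)

lemma plain_C_eq_enat:
  "plain_C D s = enat k \<longleftrightarrow>
     (\<exists>q. ev D [str_code q] = Some (str_code s) \<and> length q = k)
     \<and> (\<forall>q. ev D [str_code q] = Some (str_code s) \<longrightarrow> k \<le> length q)"
  (is "_ \<longleftrightarrow> ?R")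
proof
  let ?A = "(\<lambda>p. enat (length p)) ` {p. ev D [str_code p] = Some (str_code s)}"
  assume k: "plain_C D s = enat k"
  \<comment> \<open>The infimum of the empty set is \<infinity>, so a finite value has a
    description; the infimum is then attained.\<close>
  then have "?A \<noteq> {}" by (auto simp: plain_C_def Inf_enat_def split: if_splits)
  then have "Inf ?A \<in> ?A" unfolding Inf_enat_def by (auto intro: LeastI)
  then have "enat k \<in> ?A" using k unfolding plain_C_def by simp
  moreover have "k \<le> length q" if "ev D [str_code q] = Some (str_code s)" for q
  proof -
    have "plain_C D s \<le> enat (length q)"
      unfolding plain_C_def using that by (intro INF_lower) simp
    then show ?thesis using k by simp
  qed
  ultimately show ?R by auto
next
  assume ?R
  then show "plain_C D s = enat k"
    unfolding plain_C_def by (intro antisym INF_greatest) (auto intro: INF_lower2)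
qed

lemma sat_C_eq:
  assumes D: "has_arity D 1" and x: "val e x = str_code s"
  shows "sat e (C_eq D x k) \<longleftrightarrow> plain_C D s = enat (val e k)"
proof -
  have Len: "sat e' (Len p j) \<longleftrightarrow> (\<exists>q. val e' p = str_code q \<and> val e' j = length q)" for e' p j
    using sat_Len_str_code surj_str_code by metis
  have "sat e (C_eq D x k) \<longleftrightarrow>
      (\<exists>p. ev D [p] = Some (str_code s) \<and> (\<exists>q. p = str_code q \<and> val e k = length q))
      \<and> (\<forall>p. ev D [p] = Some (str_code s) \<longrightarrow>
            (\<forall>j. (\<forall>q. p = str_code q \<longrightarrow> j \<noteq> length q) \<or> val e k \<le> j))"
    using D by (simp add: C_eq_def Len x numeral_2_eq_2)
  also have "\<dots> \<longleftrightarrow> plain_C D s = enat (val e k)"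
    unfolding plain_C_eq_enat by metis
  finally show ?thesis .
qed

text \<open>If the complexity is infinite, no number satisfies \<open>C_eq\<close>, and the formula
  is vacuously true, as it should be.\<close>

lemma sat_C_ge:
  "has_arity D 1 \<Longrightarrow> sat e (C_ge D x m) \<longleftrightarrow> enat m \<le> plain_C D x"
  unfolding C_ge_def by (cases "plain_C D x") (auto simp: sat_C_eq)

lemma sat_C_gt:
  "has_arity D 1 \<Longrightarrow> sat e (C_gt D x m) \<longleftrightarrow> enat m < plain_C D x"
  unfolding C_gt_def by (cases "plain_C D x") (auto simp: sat_C_eq)

lemma sat_C_dominated:
  assumes "has_arity D 1" "has_arity D' 1" "sat e (C_dominated D D' c)"
  shows "plain_C D x \<le> plain_C D' x + enat c"
proof (cases "plain_C D' x")
  case (enat k)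
  let ?e = "ins 0 k (ins 0 (str_code x) e)"
  have "sat ?e (C_eq D' (Var 1) (Var 0))"
    using assms(2) enat by (simp add: sat_C_eq[where s = x])
  moreover have "sat ?e (Imp (C_eq D' (Var 1) (Var 0))
      (Exists (And (C_eq D (Var 2) (Var 0)) (Le (Var 0) (Add (Var 1) (numeral_tm c))))))"
    using assms(3) unfolding C_dominated_def sat.simps by blast
  ultimately obtain j where "sat (ins 0 j ?e) (C_eq D (Var 2) (Var 0))" "j \<le> k + c"
    by auto
  then show ?thesis using assms(1) enat by (simp add: sat_C_eq[where s = x])
qed simp

text \<open>Pigeonhole: there are 2^n strings of length n, while shorter descriptions have codes
  below 2^n - 1. Without it the \<open>Min\<close> defining \<open>first_incompressible\<close>
  would be taken over a possibly empty set.\<close>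

lemma ex_incompressible: "\<exists>x. length x = n \<and> enat n \<le> plain_C D x"
proof (rule ccontr)
  let ?A = "{x :: bool list. length x = n}"
  assume "\<not> ?thesis"
  then have short: "plain_C D x < enat n" if "x \<in> ?A" for x
    using that by (auto simp: not_le)
  have "\<exists>q. ev D [str_code q] = Some (str_code x) \<and> length q < n" if "x \<in> ?A" for x
  proof -
    have less: "plain_C D x < enat n" using that by (rule short)
    then obtain k where "plain_C D x = enat k" by (cases "plain_C D x") auto
    then show ?thesis using less plain_C_eq_enat[of D x k] by auto
  qed
  then obtain q where q: "\<And>x. x \<in> ?A \<Longrightarrow> ev D [str_code (q x)] = Some (str_code x)"
    "\<And>x. x \<in> ?A \<Longrightarrow> length (q x) < n" by metis
  have "inj_on (\<lambda>x. str_code (q x)) ?A"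
    using q(1) inj_str_code by (intro inj_onI) (metis option.inject)
  moreover have "(\<lambda>x. str_code (q x)) ` ?A \<subseteq> {..<2 ^ n - 1}"
  proof (rule image_subsetI)
    fix x assume "x \<in> ?A"
    then have "Suc (length (q x)) \<le> n" using q(2) Suc_leI by blast
    then have "(2::nat) ^ Suc (length (q x)) \<le> 2 ^ n" by (intro power_increasing) simp_all
    then have "str_code (q x) + 1 < 2 ^ n" using str_code_length[of "q x"] by simp
    then show "str_code (q x) \<in> {..<2 ^ n - 1}" by (simp add: less_diff_conv)
  qed
  ultimately have "card ?A \<le> 2 ^ n - 1"
    using card_inj_on_le[of _ ?A "{..<2 ^ n - 1}"] by fastforce
  moreover have "card ?A = 2 ^ n"
    using card_lists_length_eq[of "UNIV :: bool set" n] by simp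
  moreover have "(0::nat) < 2 ^ n" by simp
  ultimately show False by linarith
qed

lemma first_incompressible:
  "length (first_incompressible D n) = n" "enat n \<le> plain_C D (first_incompressible D n)"
proof -
  let ?X = "{x. length x = n \<and> enat n \<le> plain_C D x}"
  have "finite {x :: bool list. length x = n}"
    using finite_lists_length_eq[of "UNIV :: bool set" n] by simp
  then have "finite ?X" by (rule rev_finite_subset) auto
  moreover have "?X \<noteq> {}" using ex_incompressible by auto
  ultimately have "first_incompressible D n \<in> ?X"
    unfolding first_incompressible_def by (rule Min_in)
  then show "length (first_incompressible D n) = n"
    "enat n \<le> plain_C D (first_incompressible D n)" by auto
qed

text \<open>Read backwards, a program is a run of \<open>True\<close> ended by a
  \<open>False\<close>. Uniqueness is needed because \<open>holds\<close> only gives some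
  \<open>r\<close> and \<open>c\<close> for the program that was run.\<close>

lemma program_inject: "program r c = program r' c' \<longleftrightarrow> r = r' \<and> c = c'"
proof
  have front: "takeWhile id (replicate c True @ False # rev r) = replicate c True"
    and rest: "dropWhile id (replicate c True @ False # rev r) = False # rev r" for r c
    by (induction c) simp_all
  assume "program r c = program r' c'"
  then have "rev (r @ False # replicate c True) = rev (r' @ False # replicate c' True)"
    unfolding program_def by (rule arg_cong[OF inj_str_code])
  then have eq: "replicate c True @ False # rev r = replicate c' True @ False # rev r'"
    by simp
  have "replicate c True = replicate c' True" using front eq by metis
  then have "c = c'" by (metis length_replicate)
  moreover have "False # rev r = False # rev r'" using rest eq by metis
  ultimately show "r = r' \<and> c = c'" by simp
qed simp

theorem theorem7:
  fixes D :: recf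
  assumes "provably_optimal D"
  shows "\<exists>c::nat. \<forall>(n::nat) (x::bool list). \<not> A_theory D n \<turnstile> C_gt D x (n + c)"
proof -
  have D: "has_arity D 1" using assms by (simp add: provably_optimal_def)
  obtain F where F: "has_arity F 1"
    "\<And>p y. ev F [p] = Some y \<Longrightarrow> derives D (7 \<bullet> p \<bullet> y)"
    "\<And>p y. derives D (7 \<bullet> p \<bullet> y) \<Longrightarrow> ev F [p] \<noteq> None"
    using horn_search[of "set (search_clauses D)" 7] by blast
  then obtain c where "PA \<turnstile> C_dominated D F c"
    using assms unfolding provably_optimal_def by blast
  then have "sat e (C_dominated D F c)" for e using soundness sat_PA by blast
  then have dominated: "plain_C D x \<le> plain_C F x + enat c" for x
    using sat_C_dominated D F(1) by blast
  have "\<not> A_theory D n \<turnstile> C_gt D x (n + (c + Suc c))" for n x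
  proof
    assume asm: "A_theory D n \<turnstile> C_gt D x (n + (c + Suc c))"
    define r where "r = first_incompressible D n"
    have r: "length r = n" "enat n \<le> plain_C D r"
      unfolding r_def by (rule first_incompressible)+
    have A: "A_theory D n = PA \<union> {C_ge D r (length r)}"
      by (simp add: A_theory_def r r_def[symmetric])
    \<comment> \<open>The assumed proof is used only to make the search halt; the \<open>x'\<close>
      obtained below may be another string.\<close>
    have "ev F [program r c] \<noteq> None"
      using F(3) derives_output[OF D, of r x c] asm unfolding A r(1) by blast
    then obtain y where y: "ev F [program r c] = Some y" by auto
    then have "holds D (7 \<bullet> program r c \<bullet> y)"
      using search_sound[OF D] F(2) by blast
    then obtain x' where x': "y = str_code x'"
      "PA \<union> {C_ge D r (length r)} \<turnstile> C_gt D x' (length r + (c + Suc c))"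
      by (auto simp: holds_def program_inject)
    \<comment> \<open>The incompressibility of \<open>r\<close> enters here: it makes the added
      axiom true.\<close>
    have "sat e \<psi>" if "\<psi> \<in> PA \<union> {C_ge D r (length r)}" for \<psi> e
      using that r sat_PA sat_C_ge[OF D] by auto
    then have "sat (\<lambda>_. 0) (C_gt D x' (n + (c + Suc c)))"
      using soundness[OF x'(2)] r(1) by blast
    then have "enat (n + (c + Suc c)) < plain_C D x'"
      using sat_C_gt[OF D] by blast
    \<comment> \<open>The program that was run describes \<open>x'\<close>, and its length is n + 1
      + c.\<close>
    moreover have "plain_C F x' \<le> enat (length (r @ False # replicate c True))"
      unfolding plain_C_def using y x'(1) by (intro INF_lower) (simp add: program_def)
    then have "plain_C F x' + enat c \<le> enat (n + Suc c) + enat c"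
      using r(1) by (intro add_right_mono) simp
    then have "plain_C D x' \<le> enat (n + (c + Suc c))"
      using dominated[of x'] by (auto intro: order_trans)
    ultimately show False by simp
  qed
  then show ?thesis by blast
qed

end
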